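(* Let $q$ be a complex number with $0<|q|<1$. (1) Let $(A_m)_{m\ge 0}$, $(B_m)_{m\ge 0}$, $(C_m)_{m\ge 0}$ be the sequences each satisfying, for $m\ge 3$, the recursion $$X_m=X_{m-1}+(q^2+q^{2m-4})X_{m-2}-q^2X_{m-3}\qquad (X=A,B,C),$$ with initial values $$A_0=1,\ A_1=0,\ A_2=0;\qquad B_0=0,\ B_1=0,\ B_2=-q;\qquad C_0=q,\ C_1=q,\ C_2=q.$$ Then for every integer $m\ge 0$, $$\begin{aligned}\sum_{n=0}^{\infty}\frac{(-q;q^2)_{n+1}q^{n^2+2mn}}{(q^2;q^2)_{2n+1}}&=\frac{q^{-m}(q^3,q^{11},q^{14};q^{14})_{\infty}(q^8,q^{20};q^{28})_{\infty}(-q;q^2)_{\infty}}{(q^2;q^2)_{\infty}}A_m\\&\quad+\frac{q^{-m}(q,q^{13},q^{14};q^{14})_{\infty}(q^{12},q^{16};q^{28})_{\infty}(-q;q^2)_{\infty}}{(q^2;q^2)_{\infty}}B_m\\&\quad+\frac{q^{-m}(q^5,q^9,q^{14};q^{14})_{\infty}(q^4,q^{24};q^{28})_{\infty}(-q;q^2)_{\infty}}{(q^2;q^2)_{\infty}}C_m.\end{aligned}$$ (2) Let $(E_m)_{m\ge 0}$, $(F_m)_{m\ge 0}$, $(G_m)_{m\ge 0}$ be the sequences each satisfying, for $m\ge 3$, the recursion $$X_m=qX_{m-1}+(1+q^{2m-4})X_{m-2}-qX_{m-3}\qquad (X=E,F,G),$$ with initial values $$E_0=1,\ E_1=0,\ E_2=1;\qquad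 F_0=0,\ F_1=1,\ F_2=0;\qquad G_0=0,\ G_1=0,\ G_2=-q.$$ Then for every integer $m\ge 0$, $$\begin{aligned}\sum_{n=0}^{\infty}\frac{(-q;q^2)_nq^{n^2+2mn}}{(q^2;q^2)_{2n}}&=\frac{(q^3,q^{11},q^{14};q^{14})_{\infty}(q^8,q^{20};q^{28})_{\infty}(-q;q^2)_{\infty}}{(q^2;q^2)_{\infty}}E_m\\&\quad+\frac{(q,q^{13},q^{14};q^{14})_{\infty}(q^{12},q^{16};q^{28})_{\infty}(-q;q^2)_{\infty}}{(q^2;q^2)_{\infty}}F_m\\&\quad+\frac{(q^5,q^9,q^{14};q^{14})_{\infty}(q^4,q^{24};q^{28})_{\infty}(-q;q^2)_{\infty}}{(q^2;q^2)_{\infty}}G_m.\end{aligned}$$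
   Context: For $|p|<1$, $(a;p)_\infty=\prod_{k=0}^{\infty}(1-ap^k)$ and, for an integer $n\ge 0$, $(a;p)_n=\prod_{k=0}^{n-1}(1-ap^k)$. Multiple $q$-shifted factorials are products: $(a_1,\dots,a_r;p)_\infty=(a_1;p)_\infty\cdots(a_r;p)_\infty$. *)

theory Defs
  imports "HOL-Analysis.Analysis"
begin

definition qpoch :: "complex \<Rightarrow> complex \<Rightarrow> nat \<Rightarrow> complex" where
  "qpoch a p n = (\<Prod>k<n. 1 - a * p ^ k)"

text \<open>Only meant for \<open>norm p < 1\<close>, where the product converges.\<close>

definition qpoch_inf :: "complex \<Rightarrow> complex \<Rightarrow> complex" where
  "qpoch_inf a p = (\<Prod>k. 1 - a * p ^ k)"

definition qpoch_inf_list :: "complex list \<Rightarrow> complex \<Rightarrow> complex" where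
  "qpoch_inf_list as p = (\<Prod>a\<leftarrow>as. qpoch_inf a p)"

text \<open>The natural-number subtractions below are never truncated, since \<open>m \<ge> 3\<close>.\<close>

definition odd_sum_rec :: "complex \<Rightarrow> (nat \<Rightarrow> complex) \<Rightarrow> bool" where
  "odd_sum_rec q X \<longleftrightarrow>
     (\<forall>m\<ge>3. X m = X (m - 1) + (q ^ 2 + q ^ (2 * m - 4)) * X (m - 2) - q ^ 2 * X (m - 3))"

definition even_sum_rec :: "complex \<Rightarrow> (nat \<Rightarrow> complex) \<Rightarrow> bool" where
  "even_sum_rec q X \<longleftrightarrow>
     (\<forall>m\<ge>3. X m = q * X (m - 1) + (1 + q ^ (2 * m - 4)) * X (m - 2) - q * X (m - 3))"

end

(*
Write S m and T m for the odd and even series. Termwise,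
S m = T m + q S (m+1) and T m - T (m+2) = q^(2m+1) S (m+1). These two relations
give both third-order recursions and reduce the theorem to the three values
T 0, T 1, S 1, which are identities (117), (118), (119) on Slater's list.

With Q = q^2, the reciprocals 1/(Q;Q)_{2n}, Q^n/(Q;Q)_{2n} and Q^n/(Q;Q)_{2n+1} are
bilateral sums of c_j / ((Q;Q)_{n-j} (Q;Q)_{n+j}) (with n+j+1 in the odd case): cleared of
denominators these are polynomial identities for alternating sums of Gaussian binomials with
step 3, which follow from the Pascal rules because the extra terms cancel under a
reflection of the summation index. Interchanging summations, each inner sum over n is a
limiting q-Gauss sum, which leaves a theta series, and the quintuple product
identity with base q^14 turns that series into the product.
*)

theory Submission
  imports Defs
begin

section \<open>\<open>q\<close>-shifted factorials and a limiting \<open>q\<close>-Gauss sum\<close>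

text \<open>The base q^14 arises as follows. Written in powers of q, the finite identities carry
  exponents with leading term 12 r^2, and the q-Gauss sum adds the square of the shift, with leading
  term 9 r^2. The total 21 r^2 = 7 * 3 r^2 is the quintuple product with t = q^7, and the linear
  terms select z = q^3, q, q^5. The initial values of the six sequences are coordinates with respect
  to T 0, T 1, S 1: those of T 0, T 1, T 2 for the even family and of S 0, q S 1, q^2 S 2 for the
  odd one. For instance T 2 = T 0 - q S 1 and q^2 S 2 = q S 1 - q T 1. Multiplying S m by q^m keeps
  the odd recursion free of negative powers, whence the q^(-m) in the result. The analytic obstacle
  is that each finite identity evaluates only a difference of two bilateral sums, while the
  interchange must treat the two separately. Unordered sums (\<open>has_sum\<close>) over the
  complex numbers are absolute, so bounds on the reciprocals and Gaussian decay suffice.\<close>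

lemma qpoch_0 [simp]: "qpoch a p 0 = 1"
  by (simp add: qpoch_def)

lemma qpoch_Suc: "qpoch a p (Suc n) = qpoch a p n * (1 - a * p ^ n)"
  by (simp add: qpoch_def)

lemma qpoch_Suc_shift: "qpoch a p (Suc n) = (1 - a) * qpoch (a * p) p n"
  unfolding qpoch_def by (subst prod.lessThan_Suc_shift) (simp add: mult_ac)

lemma qpoch_add: "qpoch a p (m + n) = qpoch a p m * qpoch (a * p ^ m) p n"
  by (induction n) (simp_all add: qpoch_Suc power_add mult_ac)

lemma qpoch_eq_0_iff: "qpoch a p n = 0 \<longleftrightarrow> (\<exists>k<n. a * p ^ k = 1)"
  by (auto simp: qpoch_def)

lemma power_neq_1:
  fixes p :: complex
  assumes "norm p < 1" "n > 0"
  shows "p ^ n \<noteq> 1"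
proof
  assume "p ^ n = 1"
  then have "norm p ^ n = 1"
    by (metis norm_one norm_power)
  moreover have "norm p ^ n < 1"
    using assms by (simp add: power_less_one_iff)
  ultimately show False by simp
qed

lemma qpoch_self_neq_0:
  fixes p :: complex
  assumes "norm p < 1"
  shows "qpoch p p n \<noteq> 0"
  using power_neq_1[OF assms, of "Suc _"] by (auto simp: qpoch_eq_0_iff)

lemma convergent_prod_qpoch:
  fixes a p :: complex
  assumes "norm p < 1"
  shows "convergent_prod (\<lambda>k. 1 - a * p ^ k)"
proof -
  have "summable (\<lambda>k. norm a * norm p ^ k)"
    using assms by (intro summable_mult summable_geometric) simp
  then have "summable (\<lambda>k. norm ((1 - a * p ^ k) - 1))"
    by (simp add: norm_mult norm_power)
  then show ?thesis
    by (intro abs_convergent_prod_imp_convergent_prod summable_imp_abs_convergent_prod)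
qed

lemma qpoch_LIMSEQ:
  assumes "norm p < 1"
  shows "(\<lambda>n. qpoch a p n) \<longlonglongrightarrow> qpoch_inf a p"
  using convergent_prod_LIMSEQ[OF convergent_prod_qpoch[OF assms, of a]]
  unfolding qpoch_def qpoch_inf_def by (simp add: LIMSEQ_lessThan_iff_atMost)

lemma qpoch_inf_neq_0:
  assumes "norm p < 1" "\<And>k. a * p ^ k \<noteq> 1"
  shows "qpoch_inf a p \<noteq> 0"
  unfolding qpoch_inf_def using assms
  by (intro prodinf_nonzero convergent_prod_qpoch) auto

lemma qpoch_inf_self_neq_0:
  assumes "norm p < 1"
  shows "qpoch_inf p p \<noteq> 0"
  using power_neq_1[OF assms, of "Suc _"] assms by (intro qpoch_inf_neq_0) auto

lemma qpoch_inf_split: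
  assumes "norm p < 1"
  shows "qpoch_inf a p = qpoch a p n * qpoch_inf (a * p ^ n) p"
proof (rule LIMSEQ_unique)
  show "(\<lambda>k. qpoch a p (n + k)) \<longlonglongrightarrow> qpoch_inf a p"
    using LIMSEQ_ignore_initial_segment[OF qpoch_LIMSEQ[OF assms], of a n]
    by (simp add: add.commute)
  show "(\<lambda>k. qpoch a p (n + k)) \<longlonglongrightarrow> qpoch a p n * qpoch_inf (a * p ^ n) p"
    unfolding qpoch_add by (intro tendsto_intros qpoch_LIMSEQ assms)
qed

lemma qpoch_trisect:
  "qpoch a p (3 * n) = qpoch a (p ^ 3) n * qpoch (a * p) (p ^ 3) n * qpoch (a * p ^ 2) (p ^ 3) n"
proof (induction n)
  case (Suc n)
  have "3 * Suc n = Suc (Suc (Suc (3 * n)))"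
    by simp
  then have "qpoch a p (3 * Suc n) = qpoch a p (Suc (Suc (Suc (3 * n))))"
    by (simp only:)
  also have "\<dots> = qpoch a p (3 * n) * ((1 - a * p ^ (3 * n)) * (1 - a * p ^ Suc (3 * n))
                  * (1 - a * p ^ Suc (Suc (3 * n))))"
    by (simp add: qpoch_Suc mult_ac)
  finally show ?case
    unfolding Suc.IH qpoch_Suc power_Suc power_mult [of p 3 n] by (simp add: power2_eq_square mult_ac)
qed simp

text \<open>Residues modulo 3 of the exponent. It recombines the three factors of a triple product
  into a single Euler product in the proof of the quintuple product.\<close>

lemma qpoch_inf_trisect:
  assumes "norm p < 1"
  shows "qpoch_inf a p =
    qpoch_inf a (p ^ 3) * qpoch_inf (a * p) (p ^ 3) * qpoch_inf (a * p ^ 2) (p ^ 3)"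
proof (rule LIMSEQ_unique)
  have p3: "norm (p ^ 3) < 1"
    using assms by (simp add: norm_power power_less_one_iff)
  show "(\<lambda>n. qpoch a p (3 * n)) \<longlonglongrightarrow> qpoch_inf a p"
    using LIMSEQ_subseq_LIMSEQ[OF qpoch_LIMSEQ[OF assms], of "\<lambda>n. 3 * n" a]
    by (simp add: strict_mono_def o_def)
  show "(\<lambda>n. qpoch a p (3 * n)) \<longlonglongrightarrow>
      qpoch_inf a (p ^ 3) * qpoch_inf (a * p) (p ^ 3) * qpoch_inf (a * p ^ 2) (p ^ 3)"
    unfolding qpoch_trisect by (intro tendsto_intros qpoch_LIMSEQ p3)
qed

text \<open>The reciprocals converge because the infinite product is nonzero. The resulting bound,
  uniform in \<open>n\<close>, feeds every domination argument below.\<close>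

lemma inverse_qpoch_bounded:
  assumes "norm p < 1" "\<And>k. a * p ^ k \<noteq> 1"
  obtains K where "K > 0" "\<And>n. norm (inverse (qpoch a p n)) \<le> K"
proof -
  have "(\<lambda>n. inverse (qpoch a p n)) \<longlonglongrightarrow> inverse (qpoch_inf a p)"
    by (intro tendsto_inverse qpoch_LIMSEQ qpoch_inf_neq_0 assms)
  then have "Bseq (\<lambda>n. inverse (qpoch a p n))"
    by (intro convergent_imp_Bseq convergentI)
  then show ?thesis
    using that by (auto elim: BseqE)
qed

lemma qpoch_bounded:
  assumes "norm p < 1"
  obtains K where "K > 0" "\<And>n. norm (qpoch a p n) \<le> K"
proof -
  have "Bseq (\<lambda>n. qpoch a p n)"
    using qpoch_LIMSEQ[OF assms] by (intro convergent_imp_Bseq convergentI)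
  then show ?thesis
    using that by (auto elim: BseqE)
qed

section \<open>The limiting q-Gauss sum: domination, contiguous relation, limit\<close>

text \<open>The ratio of consecutive terms is \<open>M * s ^ (2 * k)\<close>, which tends to 0
  however large \<open>M\<close> is.\<close>

lemma summable_gaussian:
  fixes s M :: real
  assumes "0 \<le> s" "s < 1" "0 \<le> M"
  shows "summable (\<lambda>k. M ^ k * s ^ (k * (k - 1)))"
proof -
  have "(\<lambda>k. M * (s ^ 2) ^ k) \<longlonglongrightarrow> M * 0"
    using assms by (intro tendsto_intros LIMSEQ_power_zero) (auto simp: power_less_one_iff)
  then have "eventually (\<lambda>k. M * (s ^ 2) ^ k < 1 / 2) sequentially"
    by (intro order_tendstoD) auto
  then obtain N where N: "\<And>k. k \<ge> N \<Longrightarrow> M * (s ^ 2) ^ k < 1 / 2"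
    by (auto simp: eventually_sequentially)
  show ?thesis
  proof (rule summable_ratio_test[of "1 / 2" N])
    fix k assume "k \<ge> N"
    have "Suc k * (Suc k - 1) = k * (k - 1) + 2 * k"
      by (cases k) (simp_all add: algebra_simps)
    then have "M ^ Suc k * s ^ (Suc k * (Suc k - 1)) = M * (s ^ 2) ^ k * (M ^ k * s ^ (k * (k - 1)))"
      by (simp only: power_add power_mult power_Suc) (simp only: mult_ac)
    also have "\<dots> \<le> 1 / 2 * (M ^ k * s ^ (k * (k - 1)))"
      using N[OF \<open>k \<ge> N\<close>] assms by (intro mult_right_mono) auto
    finally show "norm (M ^ Suc k * s ^ (Suc k * (Suc k - 1))) \<le> 1 / 2 * norm (M ^ k * s ^ (k * (k - 1)))"
      using assms by simp
  qed simp
qed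

text \<open>The base is \<open>p = t\<^sup>2\<close>, so that \<open>t ^ (k * (k - 1))\<close> is \<open>p\<close> to the power \<open>k choose 2\<close>, and the product
  over \<open>j\<close> is \<open>x ^ k * qpoch (c / x) p k\<close>, written so that \<open>x = 0\<close> and \<open>c = 0\<close> are allowed.\<close>

definition gauss_term :: "complex \<Rightarrow> complex \<Rightarrow> complex \<Rightarrow> nat \<Rightarrow> complex" where
  "gauss_term t x c k = (- 1) ^ k * t ^ (k * (k - 1)) * (\<Prod>j<k. x - c * (t ^ 2) ^ j)
     / (qpoch (t ^ 2) (t ^ 2) k * qpoch c (t ^ 2) k)"

lemma norm_sq_less_1: "norm (t :: complex) < 1 \<Longrightarrow> norm (t ^ 2) < 1"
  by (simp add: norm_power power_less_one_iff)

text \<open>The majorant does not depend on \<open>n\<close>, the number of parameter shifts already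
  made; Tannery's theorem needs this in \<open>gauss_sum\<close>.\<close>

lemma gauss_term_bounded:
  assumes "norm t < 1" "\<And>k. c * (t ^ 2) ^ k \<noteq> 1"
  obtains K where "K > 0" "\<And>n k. norm (gauss_term t (x * (t ^ 2) ^ n) (c * (t ^ 2) ^ n) k)
    \<le> K * ((norm x + norm c) ^ k * norm t ^ (k * (k - 1)))"
proof -
  define p where "p = t ^ 2"
  have p: "norm p < 1"
    using norm_sq_less_1[OF assms(1)] by (simp add: p_def)
  have c: "c * p ^ k \<noteq> 1" for k
    using assms(2) by (simp add: p_def)
  obtain K1 where K1: "K1 > 0" "\<And>n. norm (inverse (qpoch p p n)) \<le> K1"
    using inverse_qpoch_bounded[OF p, of p] power_neq_1[OF p, of "Suc _"] by auto
  obtain K2 where K2: "K2 > 0" "\<And>n. norm (inverse (qpoch c p n)) \<le> K2"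
    using inverse_qpoch_bounded[OF p c] by auto
  obtain K3 where K3: "K3 > 0" "\<And>n. norm (qpoch c p n) \<le> K3"
    using qpoch_bounded[OF p] by auto
  have pk: "norm p ^ k \<le> 1" for k
    using p by (simp add: power_le_one)
  have "norm (gauss_term t (x * p ^ n) (c * p ^ n) k)
      \<le> K1 * (K3 * K2) * ((norm x + norm c) ^ k * norm t ^ (k * (k - 1)))" for n k
  proof -
    \<comment> \<open>As a quotient of two factorials with the fixed parameter \<open>c\<close>, the
      shifted reciprocal is bounded uniformly in \<open>n\<close> and \<open>k\<close>.\<close>
    have "inverse (qpoch (c * p ^ n) p k) = qpoch c p n * inverse (qpoch c p (n + k))"
      using c by (auto simp: qpoch_add qpoch_eq_0_iff divide_simps)
    then have d: "norm (inverse (qpoch (c * p ^ n) p k)) \<le> K3 * K2"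
      using K2 K3 by (auto simp: norm_mult intro!: mult_mono simp del: norm_inverse)
    have "norm (x * p ^ n - c * p ^ n * p ^ j) \<le> norm x + norm c" for j
    proof -
      have "norm (x * p ^ n - c * p ^ n * p ^ j) \<le> norm x * norm p ^ n + norm c * norm p ^ (n + j)"
        using norm_triangle_ineq4[of "x * p ^ n" "c * p ^ n * p ^ j"]
        by (simp add: norm_mult norm_power power_add mult_ac)
      also have "\<dots> \<le> norm x * 1 + norm c * 1"
        by (intro add_mono mult_left_mono pk) auto
      finally show ?thesis by simp
    qed
    then have "norm (\<Prod>j<k. x * p ^ n - c * p ^ n * p ^ j) \<le> (\<Prod>j<k. norm x + norm c)"
      unfolding prod_norm [symmetric] by (intro prod_mono) auto
    then have e: "norm (\<Prod>j<k. x * p ^ n - c * p ^ n * p ^ j) \<le> (norm x + norm c) ^ k"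
      by simp
    have "norm (gauss_term t (x * p ^ n) (c * p ^ n) k) =
        norm t ^ (k * (k - 1)) * norm (\<Prod>j<k. x * p ^ n - c * p ^ n * p ^ j)
        * (norm (inverse (qpoch p p k)) * norm (inverse (qpoch (c * p ^ n) p k)))"
      by (simp add: gauss_term_def p_def [symmetric] norm_mult norm_power divide_inverse)
    also have "\<dots> \<le> norm t ^ (k * (k - 1)) * (norm x + norm c) ^ k * (K1 * (K3 * K2))"
      using K1 K2 K3 d e by (intro mult_mono) (auto simp del: norm_inverse)
    finally show ?thesis
      by (simp add: mult_ac)
  qed
  then show ?thesis
    using K1 K2 K3 that[of "K1 * (K3 * K2)"] by (simp add: p_def)
qed

lemma summable_norm_gauss_term:
  assumes "norm t < 1" "\<And>k. c * (t ^ 2) ^ k \<noteq> 1"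
  shows "summable (\<lambda>k. norm (gauss_term t x c k))"
proof -
  obtain K where "\<And>n k. norm (gauss_term t (x * (t ^ 2) ^ n) (c * (t ^ 2) ^ n) k)
    \<le> K * ((norm x + norm c) ^ k * norm t ^ (k * (k - 1)))"
    using gauss_term_bounded[OF assms] by metis
  note K = this[of 0]
  have "summable (\<lambda>k. K * ((norm x + norm c) ^ k * norm t ^ (k * (k - 1))))"
    using assms(1) by (intro summable_mult summable_gaussian) auto
  then show ?thesis
    by (rule summable_comparison_test'[of _ 0]) (use K in simp)
qed

text \<open>A telescoping certificate: the right side is \<open>D k - D (Suc k)\<close> for
  \<open>D k = gauss_term t x c k * (1 - (t ^ 2) ^ k)\<close>. Since \<open>D 0 = 0\<close> and
  \<open>D\<close> tends to 0, summation yields the contiguous relation without boundary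
  terms.\<close>

lemma gauss_term_telescope:
  assumes "norm t < 1" "\<And>k. c * (t ^ 2) ^ k \<noteq> 1"
  shows "gauss_term t x c k - (1 - x) / (1 - c) * gauss_term t (x * t ^ 2) (c * t ^ 2) k
    = gauss_term t x c k * (1 - (t ^ 2) ^ k) - gauss_term t x c (Suc k) * (1 - (t ^ 2) ^ Suc k)"
proof -
  define p P where "p = t ^ 2" and "P = gauss_term t x c k"
  have p: "norm p < 1"
    using norm_sq_less_1[OF assms(1)] by (simp add: p_def)
  have c: "c * p ^ k \<noteq> 1" for k
    using assms(2) by (simp add: p_def)
  have c1: "1 - c \<noteq> 0"
    using c[of 0] by simp
  have ck: "1 - c * p ^ k \<noteq> 0"
    using c by simp
  have qc: "qpoch c p k \<noteq> 0" "qpoch p p k \<noteq> 0" "1 - p ^ Suc k \<noteq> 0"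
    using c qpoch_self_neq_0[OF p] power_neq_1[OF p, of "Suc k"] by (auto simp: qpoch_eq_0_iff)
  have a: "gauss_term t (x * p) (c * p) k = (1 - c) * p ^ k * P / (1 - c * p ^ k)"
  proof -
    have "(\<Prod>j<k. x * p - c * p * p ^ j) = (\<Prod>j<k. p * (x - c * p ^ j))"
      by (simp add: algebra_simps)
    also have "\<dots> = p ^ k * (\<Prod>j<k. x - c * p ^ j)"
      by (simp add: prod.distrib)
    finally have 1: "(\<Prod>j<k. x * p - c * p * p ^ j) = p ^ k * (\<Prod>j<k. x - c * p ^ j)" .
    have "(1 - c) * qpoch (c * p) p k = qpoch c p k * (1 - c * p ^ k)"
      by (simp add: qpoch_Suc_shift [symmetric] qpoch_Suc)
    then have 2: "qpoch (c * p) p k = qpoch c p k * (1 - c * p ^ k) / (1 - c)"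
      using c1 by (simp add: field_simps)
    show ?thesis
      unfolding P_def gauss_term_def p_def [symmetric] 1 2 by (simp add: mult_ac)
  qed
  have b: "gauss_term t x c (Suc k) * (1 - p ^ Suc k) = - (p ^ k * (x - c * p ^ k) * P / (1 - c * p ^ k))"
  proof -
    have "Suc k * (Suc k - 1) = k * (k - 1) + 2 * k"
      by (cases k) (simp_all add: algebra_simps)
    then have 1: "t ^ (Suc k * (Suc k - 1)) = t ^ (k * (k - 1)) * p ^ k"
      by (simp only: power_add power_mult p_def)
    have 2: "qpoch p p (Suc k) = qpoch p p k * (1 - p ^ Suc k)"
      by (simp add: qpoch_Suc)
    show ?thesis
      unfolding P_def gauss_term_def p_def [symmetric] 1 2 qpoch_Suc[of c]
      using qc by (simp del: power_Suc)  (simp add: mult_ac)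
  qed
  \<comment> \<open>By \<open>a\<close> and \<open>b\<close> every term is a rational multiple of
    \<open>P\<close>, so only an identity of rational functions in \<open>x\<close>,
    \<open>c\<close> and \<open>p ^ k\<close> remains.\<close>
  have "P - (1 - x) / (1 - c) * ((1 - c) * p ^ k * P / (1 - c * p ^ k))
      = P * (1 - p ^ k) - - (p ^ k * (x - c * p ^ k) * P / (1 - c * p ^ k))"
    using c1 ck by (simp add: divide_simps) (simp add: algebra_simps)
  then show ?thesis
    unfolding p_def [symmetric] a b P_def [symmetric] .
qed

lemma suminf_gauss_term_shift:
  assumes "norm t < 1" "\<And>k. c * (t ^ 2) ^ k \<noteq> 1"
  shows "suminf (gauss_term t x c)
    = (1 - x) / (1 - c) * suminf (gauss_term t (x * t ^ 2) (c * t ^ 2))"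
proof -
  define D where "D k = gauss_term t x c k * (1 - (t ^ 2) ^ k)" for k
  have s1: "summable (gauss_term t x c)"
    using summable_norm_gauss_term[OF assms] by (rule summable_norm_cancel)
  have s2: "summable (gauss_term t (x * t ^ 2) (c * t ^ 2))"
    using assms(2)[of "Suc _"]
    by (intro summable_norm_cancel[OF summable_norm_gauss_term] assms(1)) (simp add: mult_ac)
  have pk: "(\<lambda>k. (t ^ 2) ^ k) \<longlonglongrightarrow> 0"
    using norm_sq_less_1[OF assms(1)] by (rule LIMSEQ_power_zero)
  have "D \<longlonglongrightarrow> 0 * (1 - 0)"
    unfolding D_def by (intro tendsto_mult tendsto_diff tendsto_const summable_LIMSEQ_zero s1 pk)
  then have "(\<lambda>k. D k - D (Suc k)) sums (D 0 - 0)"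
    by (intro telescope_sums') simp_all
  moreover have "(\<lambda>k. D k - D (Suc k)) =
      (\<lambda>k. gauss_term t x c k - (1 - x) / (1 - c) * gauss_term t (x * t ^ 2) (c * t ^ 2) k)"
    using gauss_term_telescope[OF assms] by (simp add: D_def)
  moreover have "(\<lambda>k. gauss_term t x c k - (1 - x) / (1 - c) * gauss_term t (x * t ^ 2) (c * t ^ 2) k)
     sums (suminf (gauss_term t x c)
           - (1 - x) / (1 - c) * suminf (gauss_term t (x * t ^ 2) (c * t ^ 2)))"
    by (intro sums_diff sums_mult summable_sums s1 s2)
  ultimately have "D 0 - 0 = suminf (gauss_term t x c)
           - (1 - x) / (1 - c) * suminf (gauss_term t (x * t ^ 2) (c * t ^ 2))"
    by (metis sums_unique2)
  then show ?thesis
    by (simp add: D_def)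
qed

text \<open>Iterating the shift moves \<open>(x, c)\<close> to \<open>(0, 0)\<close>, where the series is \<open>1\<close>.\<close>

theorem gauss_sum:
  assumes "norm t < 1" "\<And>k. c * (t ^ 2) ^ k \<noteq> 1"
  shows "gauss_term t x c sums (qpoch_inf x (t ^ 2) / qpoch_inf c (t ^ 2))"
proof -
  define p where "p = t ^ 2"
  have p: "norm p < 1"
    using norm_sq_less_1[OF assms(1)] by (simp add: p_def)
  have c: "c * p ^ k \<noteq> 1" for k
    using assms(2) by (simp add: p_def)
  define S where "S n = suminf (gauss_term t (x * p ^ n) (c * p ^ n))" for n
  have S0: "S 0 = qpoch x p n / qpoch c p n * S n" for n
  proof (induction n)
    case (Suc n)
    have "S n = (1 - x * p ^ n) / (1 - c * p ^ n) * S (Suc n)"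
      unfolding S_def using c[of "n + _"]
      by (subst suminf_gauss_term_shift[OF assms(1)])
        (simp_all add: p_def [symmetric] power_add mult_ac)
    then show ?case
      by (simp add: Suc.IH qpoch_Suc)
  qed simp
  obtain K where K: "\<And>n k. norm (gauss_term t (x * p ^ n) (c * p ^ n) k)
    \<le> K * ((norm x + norm c) ^ k * norm t ^ (k * (k - 1)))"
    using gauss_term_bounded[OF assms] unfolding p_def by metis
  have lim: "(\<lambda>n. gauss_term t (x * p ^ n) (c * p ^ n) k) \<longlonglongrightarrow> (if k = 0 then 1 else 0)" for k
  proof -
    have pn: "(\<lambda>n. p ^ n) \<longlonglongrightarrow> 0"
      by (intro LIMSEQ_power_zero p)
    have "(\<lambda>n. gauss_term t (x * p ^ n) (c * p ^ n) k) \<longlonglongrightarrow> gauss_term t (x * 0) (c * 0) k"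
      unfolding gauss_term_def qpoch_def[of "_ * _"] p_def [symmetric]
      by (intro tendsto_intros pn) (auto simp: qpoch_self_neq_0[OF p])
    \<comment> \<open>For \<open>k > 0\<close> the factors \<open>x - c * p ^ j\<close> all vanish
      at \<open>x = c = 0\<close>, so only \<open>k = 0\<close> survives.\<close>
    moreover have "gauss_term t (x * 0) (c * 0) k = (if k = 0 then 1 else 0)"
      by (auto simp: gauss_term_def)
    ultimately show ?thesis by simp
  qed
  have summable: "summable (\<lambda>k. K * ((norm x + norm c) ^ k * norm t ^ (k * (k - 1))))"
    using assms(1) by (intro summable_mult summable_gaussian) auto
  have "(\<lambda>n. S n) \<longlonglongrightarrow> (\<Sum>k. if k = 0 then 1 else 0)"
    unfolding S_def
    using tannerys_theorem[of "\<lambda>k n. gauss_term t (x * p ^ n) (c * p ^ n) k", OF lim _ summable] K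
    by (simp add: case_prod_unfold)
  moreover have "(\<Sum>k. if k = 0 then 1 else 0 :: complex) = 1"
    by (subst suminf_finite[of "{0}"]) auto
  ultimately have "S \<longlonglongrightarrow> 1"
    by simp
  then have "(\<lambda>n. qpoch x p n / qpoch c p n * S n) \<longlonglongrightarrow> qpoch_inf x p / qpoch_inf c p * 1"
    by (intro tendsto_intros qpoch_LIMSEQ qpoch_inf_neq_0 p c)
  then have "S 0 = qpoch_inf x p / qpoch_inf c p"
    by (simp only: S0 [symmetric] LIMSEQ_const_iff mult_1_right)
  moreover have "summable (gauss_term t x c)"
    using summable_norm_gauss_term[OF assms] by (rule summable_norm_cancel)
  ultimately show ?thesis
    by (simp add: S_def p_def sums_iff)
qed

section \<open>Triple and quintuple products\<close>

text \<open>Complex unordered summability is absolute, so the norms form a summable product family;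
  this supplies the summability that the iterated sum alone would not give.\<close>

lemma has_sum_product_complex:
  fixes f :: "'a \<Rightarrow> complex" and g :: "'b \<Rightarrow> complex"
  assumes f: "(f has_sum F) A" and g: "(g has_sum G) B"
  shows "((\<lambda>(a, b). f a * g b) has_sum F * G) (A \<times> B)"
proof (rule has_sum_SigmaI)
  show "((\<lambda>y. case (x, y) of (a, b) \<Rightarrow> f a * g b) has_sum f x * G) B" for x
    using has_sum_cmult_right[OF g] by simp
  show "((\<lambda>x. f x * G) has_sum F * G) A"
    by (rule has_sum_cmult_left[OF f])
  have fa: "(\<lambda>x. norm (f x)) summable_on A" and ga: "(\<lambda>x. norm (g x)) summable_on B"
    using f g by (auto simp flip: summable_on_iff_abs_summable_on_complex simp: has_sum_imp_summable)
  have "(\<lambda>x. norm (case x of (a, b) \<Rightarrow> f a * g b)) summable_on A \<times> B"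
    unfolding Infinite_Sum.abs_summable_on_Sigma_iff
  proof (intro conjI ballI)
    show "(\<lambda>y. norm (case (x, y) of (a, b) \<Rightarrow> f a * g b)) summable_on B" for x
      using summable_on_cmult_right[OF ga] by (simp add: norm_mult)
    show "(\<lambda>x. norm (\<Sum>\<^sub>\<infinity>y\<in>B. norm (case (x, y) of (a, b) \<Rightarrow> f a * g b))) summable_on A"
      using summable_on_cmult_left[OF fa, of "\<Sum>\<^sub>\<infinity>y\<in>B. norm (g y)"]
      by (simp add: norm_mult infsum_cmult_right' infsum_nonneg)
  qed
  then show "(\<lambda>(a, b). f a * g b) summable_on A \<times> B"
    by (rule abs_summable_summable)
qed

lemma has_sum_int_shift_nat:
  fixes g :: "int \<Rightarrow> 'a :: {comm_monoid_add, topological_space}"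
  assumes "\<And>k. k < K \<Longrightarrow> g k = 0"
  shows "(g has_sum S) UNIV \<longleftrightarrow> ((\<lambda>n. g (K + int n)) has_sum S) UNIV"
proof -
  have "bij_betw (\<lambda>n. K + int n) UNIV {K..}"
    by (rule bij_betwI[of _ _ _ "\<lambda>k. nat (k - K)"]) auto
  then have "((\<lambda>n. g (K + int n)) has_sum S) UNIV \<longleftrightarrow> (g has_sum S) {K..}"
    by (rule has_sum_reindex_bij_betw)
  also have "\<dots> \<longleftrightarrow> (g has_sum S) UNIV"
    using assms by (intro has_sum_cong_neutral) auto
  finally show ?thesis by simp
qed

text \<open>Extending the reciprocal by zero makes it satisfy its recurrence at every integer.\<close>

definition rpoch :: "complex \<Rightarrow> int \<Rightarrow> complex" where
  "rpoch p k = (if k < 0 then 0 else 1 / qpoch p p (nat k))"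

lemma rpoch_neg [simp]: "k < 0 \<Longrightarrow> rpoch p k = 0"
  by (simp add: rpoch_def)

lemma rpoch_of_nat [simp]: "rpoch p (int n) = 1 / qpoch p p n"
  by (simp add: rpoch_def)

lemma rpoch_minus_1:
  assumes "norm p < 1"
  shows "rpoch p (k - 1) = (1 - p powi k) * rpoch p k"
proof (cases "k > 0")
  case True
  define n where "n = nat (k - 1)"
  have k: "k = int (Suc n)"
    using True by (simp add: n_def)
  have "1 - p ^ Suc n \<noteq> 0"
    using power_neq_1[OF assms, of "Suc n"] by simp
  moreover have "qpoch p p (Suc n) = qpoch p p n * (1 - p ^ Suc n)"
    by (simp add: qpoch_Suc)
  moreover have "rpoch p (k - 1) = 1 / qpoch p p n" "rpoch p k = 1 / qpoch p p (Suc n)"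
    unfolding rpoch_of_nat [symmetric] k by simp_all
  ultimately show ?thesis
    unfolding k power_int_of_nat by simp
\<comment> \<open>At \<open>k = 0\<close> the factor \<open>1 - p powi 0\<close> vanishes, in
  agreement with \<open>rpoch p (- 1) = 0\<close>.\<close>
qed (cases "k = 0", auto)

lemma gauss_has_sum:
  assumes "norm t < 1" "\<And>k. c * (t ^ 2) ^ k \<noteq> 1"
  shows "(gauss_term t x c has_sum (qpoch_inf x (t ^ 2) / qpoch_inf c (t ^ 2))) UNIV"
  using summable_norm_gauss_term[OF assms] gauss_sum[OF assms] by (rule norm_summable_imp_has_sum)

text \<open>Euler's expansion, the case \<open>c = 0\<close> of the q-Gauss sum.\<close>

lemma euler_has_sum:
  assumes "norm t < 1"
  shows "((\<lambda>k. (- 1) ^ k * t ^ (k * (k - 1)) * x ^ k * rpoch (t ^ 2) (int k))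
    has_sum qpoch_inf x (t ^ 2)) UNIV"
proof -
  have "qpoch 0 (t ^ 2) k = 1" for k
    by (simp add: qpoch_def)
  moreover have "qpoch_inf 0 (t ^ 2) = 1"
    by (simp add: qpoch_inf_def)
  ultimately show ?thesis
    using gauss_has_sum[OF assms, of 0 x] by (simp add: gauss_term_def [abs_def])
qed

text \<open>The q-Gauss sum at \<open>c = p ^ (N + 1)\<close>, where p is \<open>t ^ 2\<close>. This
  choice turns \<open>qpoch c p k\<close> into \<open>qpoch p p (k + N) / qpoch p p N\<close>, so
  both denominators become values of \<open>rpoch\<close>.\<close>

lemma rpoch_gauss_has_sum:
  assumes "norm t < 1"
  shows "((\<lambda>k. (- 1) ^ k * t ^ (k * (k - 1)) * (\<Prod>j<k. x - t ^ (2 * N + 2 + 2 * j))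
      * rpoch (t ^ 2) (int k) * rpoch (t ^ 2) (int k + int N))
    has_sum (qpoch_inf x (t ^ 2) / qpoch_inf (t ^ 2) (t ^ 2))) UNIV"
proof -
  define p where "p = t ^ 2"
  have p: "norm p < 1"
    using norm_sq_less_1[OF assms] by (simp add: p_def)
  have c: "p ^ (N + 1) * p ^ k \<noteq> 1" for k
    using power_neq_1[OF p, of "N + 1 + k"] by (simp add: power_add mult_ac)
  have "qpoch p p (k + N) = qpoch p p N * qpoch (p ^ (N + 1)) p k" for k
    by (subst add.commute) (simp add: qpoch_add)
  then have 1: "rpoch p (int k + int N) = 1 / (qpoch p p N * qpoch (p ^ (N + 1)) p k)" for k
    unfolding of_nat_add [symmetric] rpoch_of_nat by simp
  have 2: "t ^ (2 * N + 2 + 2 * j) = p ^ (N + 1) * p ^ j" for j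
    by (simp add: p_def flip: power_mult power_add)
  have 3: "(\<lambda>k. (- 1) ^ k * t ^ (k * (k - 1)) * (\<Prod>j<k. x - t ^ (2 * N + 2 + 2 * j))
      * rpoch p (int k) * rpoch p (int k + int N)) = (\<lambda>k. gauss_term t x (p ^ (N + 1)) k / qpoch p p N)"
    unfolding 1 2 gauss_term_def p_def [symmetric] by (simp add: mult_ac)
  have "qpoch_inf p p = qpoch p p N * qpoch_inf (p ^ (N + 1)) p"
    by (subst qpoch_inf_split[OF p, of _ N]) simp
  then have 4: "qpoch_inf x p / qpoch_inf p p = qpoch_inf x p / qpoch_inf (p ^ (N + 1)) p / qpoch p p N"
    by simp
  show ?thesis
    unfolding p_def [symmetric] 3 4
    using gauss_has_sum[OF assms, of "p ^ (N + 1)" x] c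
    by (intro has_sum_divide_const) (simp add: p_def)
qed

section \<open>Durfee rectangles and the triple product\<close>

text \<open>Cauchy's Durfee rectangle identity, obtained from \<open>x = 0\<close> in
  \<open>rpoch_gauss_has_sum\<close>. What matters is that the value is the same for every
  \<open>N\<close>.\<close>

lemma durfee_has_sum:
  fixes N :: int
  assumes "norm t < 1" "t \<noteq> 0"
  shows "((\<lambda>b. t powi (2 * b * (b + N)) * rpoch (t ^ 2) b * rpoch (t ^ 2) (b + N))
    has_sum (1 / qpoch_inf (t ^ 2) (t ^ 2))) UNIV"
proof -
  have nonneg: "((\<lambda>b. t powi (2 * b * (b + int N)) * rpoch (t ^ 2) b * rpoch (t ^ 2) (b + int N))
    has_sum (1 / qpoch_inf (t ^ 2) (t ^ 2))) UNIV" for N :: nat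
  proof -
    have *: "(- 1) ^ k * t ^ (k * (k - 1)) * (\<Prod>j<k. 0 - t ^ (2 * N + 2 + 2 * j))
        = t powi (2 * int k * (int k + int N))" for k
    proof (induction k)
      case (Suc k)
      have "Suc k * (Suc k - 1) = k * (k - 1) + 2 * k"
        by (cases k) (simp_all add: algebra_simps)
      then have "t ^ (Suc k * (Suc k - 1)) = t ^ (k * (k - 1)) * t ^ (2 * k)"
        by (simp only: power_add)
      then have "(- 1) ^ Suc k * t ^ (Suc k * (Suc k - 1)) * (\<Prod>j<Suc k. 0 - t ^ (2 * N + 2 + 2 * j))
        = ((- 1) ^ k * t ^ (k * (k - 1)) * (\<Prod>j<k. 0 - t ^ (2 * N + 2 + 2 * j)))
          * (t ^ (2 * k) * t ^ (2 * N + 2 + 2 * k))"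
        by simp
      also have "\<dots> = t powi (2 * int k * (int k + int N)) * t powi int (4 * k + 2 * N + 2)"
        unfolding Suc.IH power_int_of_nat power_add [symmetric] by simp
      also have "\<dots> = t powi (2 * int (Suc k) * (int (Suc k) + int N))"
        using assms(2) by (simp add: algebra_simps flip: power_int_add)
      finally show ?case .
    qed simp
    have "qpoch_inf 0 (t ^ 2) = 1"
      by (simp add: qpoch_inf_def)
    then show ?thesis
      using rpoch_gauss_has_sum[OF assms(1), of 0 N]
      unfolding * by (subst has_sum_int_shift_nat[of 0]) simp_all
  qed
  show ?thesis
  proof (cases "N \<ge> 0")
    case True
    then show ?thesis
      using nonneg[of "nat N"] by simp
  next
    case False
    \<comment> \<open>Shifting \<open>b\<close> by \<open>N\<close> exchanges the two
      \<open>rpoch\<close> factors and so reduces \<open>N\<close> to \<open>- N\<close>.\<close>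
    have "bij_betw (\<lambda>b. b + N) UNIV UNIV"
      by (rule bij_betwI[of _ _ _ "\<lambda>b. b - N"]) auto
    from has_sum_reindex_bij_betw[OF this, THEN iffD2, OF nonneg[of "nat (- N)"]] False
    show ?thesis
      by (simp add: mult_ac)
  qed
qed

lemma minus_one_powi_add: "(- 1 :: complex) powi (a + b) = (- 1) powi a * (- 1) powi b"
  by (simp add: power_int_add)

lemma minus_one_powi_double: "(- 1 :: complex) powi a * (- 1) powi a = 1"
  by (simp flip: power_int_mult_distrib)

lemma minus_one_powi_diff: "(- 1 :: complex) powi (a - b) = (- 1) powi a * (- 1) powi b"
  using minus_one_powi_add[of "a - b" b] minus_one_powi_double[of b] by (simp add: mult.assoc)

text \<open>Multiply Euler's expansions of the products at \<open>z\<close> and \<open>p / z\<close>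
  and collect the pairs \<open>(a, b)\<close> with \<open>a - b = N\<close>. The sum over
  \<open>b\<close> is then a Durfee sum, independent of \<open>N\<close>, and it contributes the
  reciprocal of the third product.\<close>

theorem jacobi_triple_product:
  fixes t z :: complex
  assumes "norm t < 1" "t \<noteq> 0" "z \<noteq> 0"
  shows "((\<lambda>n. (- 1) powi n * t powi (n * (n - 1)) * z powi n) has_sum
    (qpoch_inf z (t ^ 2) * qpoch_inf (t ^ 2 / z) (t ^ 2) * qpoch_inf (t ^ 2) (t ^ 2))) UNIV"
proof -
  define p where "p = t ^ 2"
  have p: "norm p < 1" "p \<noteq> 0"
    using norm_sq_less_1[OF assms(1)] assms(2) by (simp_all add: p_def)
  define u where "u x a = (- 1) powi a * t powi (a * (a - 1)) * x powi a * rpoch p a" for x a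
  have u: "(u x has_sum qpoch_inf x p) UNIV" for x
  proof -
    have "int k * (int k - 1) = int (k * (k - 1))" for k
      by (cases k) (simp_all add: algebra_simps)
    then have "u x (int k) = (- 1) ^ k * t ^ (k * (k - 1)) * x ^ k * rpoch (t ^ 2) (int k)" for k
      unfolding u_def p_def by (simp only: power_int_of_nat)
    then show ?thesis
      using euler_has_sum[OF assms(1), of x] unfolding p_def
      by (subst has_sum_int_shift_nat[of 0]) (simp_all only: add_0, simp add: u_def p_def)
  qed
  have "bij_betw (\<lambda>(N :: int, b :: int). (b + N, b)) (UNIV \<times> UNIV) (UNIV \<times> UNIV)"
    by (rule bij_betwI[of _ _ _ "\<lambda>(a, b). (a - b, b)"]) auto
  from has_sum_reindex_bij_betw[OF this, THEN iffD2,
      OF has_sum_product_complex[OF u[of z] u[of "p / z"]]]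
  have *: "((\<lambda>(N, b). u z (b + N) * u (p / z) b) has_sum qpoch_inf z p * qpoch_inf (p / z) p) (UNIV \<times> UNIV)"
    by (simp add: case_prod_unfold)
  define w where "w n = (- 1) powi n * t powi (n * (n - 1)) * z powi n" for n :: int
  have inner: "u z (b + N) * u (p / z) b
      = w N * (t powi (2 * b * (b + N)) * rpoch p b * rpoch p (b + N))" for N b
  proof -
    have "p powi b = t powi (2 * b)"
      by (simp add: p_def power_int_mult)
    then have "u z (b + N) * u (p / z) b = ((- 1) powi b * (- 1) powi b) * (- 1) powi N
        * (t powi ((b + N) * (b + N - 1)) * t powi (b * (b - 1)) * t powi (2 * b))
        * (z powi (b + N) / z powi b) * (rpoch p b * rpoch p (b + N))"
      by (simp add: u_def minus_one_powi_add power_int_divide_distrib mult_ac)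
    also have "z powi (b + N) / z powi b = z powi N"
      using assms(3) by (simp add: power_int_add)
    also have "t powi ((b + N) * (b + N - 1)) * t powi (b * (b - 1)) * t powi (2 * b)
        = t powi (N * (N - 1)) * t powi (2 * b * (b + N))"
      using assms(2) by (simp flip: power_int_add) (simp add: algebra_simps)
    finally show ?thesis
      by (simp add: w_def minus_one_powi_double mult_ac)
  qed
  have "((\<lambda>N. w N * (1 / qpoch_inf p p)) has_sum qpoch_inf z p * qpoch_inf (p / z) p) UNIV"
  proof (rule has_sum_SigmaD[OF *])
    fix N :: int
    show "((\<lambda>b. case (N, b) of (N, b) \<Rightarrow> u z (b + N) * u (p / z) b) has_sum w N * (1 / qpoch_inf p p)) UNIV"
      using has_sum_cmult_right[OF durfee_has_sum[OF assms(1,2)]]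
      by (simp only: prod.case inner p_def [symmetric])
  qed
  from has_sum_cmult_left[OF this, of "qpoch_inf p p"] qpoch_inf_self_neq_0[OF p(1)]
  show ?thesis
    by (simp add: p_def w_def mult.assoc)
qed

text \<open>Multiply the triple product for \<open>z\<close> in base \<open>p\<close> by the one for \<open>p z\<^sup>2\<close> in base \<open>p\<^sup>2\<close>, and substitute
  \<open>(n, m) = (k - 2 l + i, k + l)\<close>, where \<open>i = (n - m) mod 3\<close>. The double sum then factors for each \<open>i\<close>;
  the sum over \<open>l\<close> is the same pentagonal series for \<open>i = 0, 1\<close> and vanishes for \<open>i = 2\<close>.\<close>

theorem quintuple_product:
  fixes t z :: complex
  assumes "norm t < 1" "t \<noteq> 0" "z \<noteq> 0"
  defines "p \<equiv> t ^ 2"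
  shows "(\<lambda>k. t powi (3 * k ^ 2 - k) * z powi (3 * k)) summable_on UNIV"
    and "(\<lambda>k. t powi (3 * k ^ 2 + k) * z powi (3 * k + 1)) summable_on UNIV"
    and "(\<Sum>\<^sub>\<infinity>k. t powi (3 * k ^ 2 - k) * z powi (3 * k))
       - (\<Sum>\<^sub>\<infinity>k. t powi (3 * k ^ 2 + k) * z powi (3 * k + 1))
       = qpoch_inf z p * qpoch_inf (p / z) p * qpoch_inf p p
         * qpoch_inf (p * z ^ 2) (p ^ 2) * qpoch_inf (p / z ^ 2) (p ^ 2)"
proof -
  have p: "norm p < 1" "p \<noteq> 0"
    using norm_sq_less_1[OF assms(1)] assms(2) by (simp_all add: p_def)
  have pp: "norm (p ^ 2) < 1"
    using norm_sq_less_1[OF p(1)] .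
  define H where "H = qpoch_inf (p ^ 2) (p ^ 2)"
  have H0: "H \<noteq> 0"
    unfolding H_def by (rule qpoch_inf_self_neq_0[OF pp])
  define J1 where "J1 = qpoch_inf z p * qpoch_inf (p / z) p * qpoch_inf p p"
  define J2 where "J2 = qpoch_inf (p * z ^ 2) (p ^ 2) * qpoch_inf (p / z ^ 2) (p ^ 2)"
  define f where "f = (\<lambda>(n, m). ((- 1) powi n * t powi (n * (n - 1)) * z powi n)
      * ((- 1) powi m * p powi (m * (m - 1)) * (p * z ^ 2) powi m))"
  have f_sum: "(f has_sum J1 * (J2 * H)) UNIV"
  proof -
    have "p ^ 2 / (p * z ^ 2) = p / z ^ 2"
      using p by (simp add: power2_eq_square)
    then show ?thesis
      using has_sum_product_complex[OF jacobi_triple_product[OF assms(1-3)]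
        jacobi_triple_product[of p "p * z ^ 2"]] p assms(3)
      unfolding f_def J1_def J2_def H_def by (simp add: p_def [symmetric])
  qed

  \<comment> \<open>The factor depending on \<open>l\<close> after the substitution; by
    \<open>h_eq\<close> it is again a triple product series, in base \<open>t ^ 12\<close>.\<close>
  define h where "h i l = (- 1) powi l * t powi (6 * l ^ 2 + (2 - 4 * i) * l)" for i l :: int
  have t6: "norm (t ^ 6) < 1"
    using assms(1) by (simp add: norm_power power_less_one_iff)
  have h_eq: "h i l = (- 1) powi l * (t ^ 6) powi (l * (l - 1)) * (t powi (8 - 4 * i)) powi l" for i l
  proof -
    have "(t ^ 6) powi (l * (l - 1)) * (t powi (8 - 4 * i)) powi l
        = t powi (6 * l ^ 2 + (2 - 4 * i) * l)"
      unfolding power_int_power power_int_mult [symmetric] power_int_add[OF disjI1[OF assms(2)], symmetric]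
      by (simp add: power2_eq_square algebra_simps)
    then show ?thesis
      by (simp add: h_def mult.assoc)
  qed
  have h_sum: "(h i has_sum (qpoch_inf (t powi (8 - 4 * i)) (t ^ 12)
      * qpoch_inf (t powi (4 + 4 * i)) (t ^ 12) * qpoch_inf (t ^ 12) (t ^ 12))) UNIV" for i
  proof -
    have 1: "(t ^ 6) ^ 2 = t ^ 12"
      by (simp flip: power_mult)
    have 2: "t ^ 12 / t powi (8 - 4 * i) = t powi (4 + 4 * i)"
      using assms(2) by (simp flip: power_int_numeral power_int_diff)
    show ?thesis
      using jacobi_triple_product[OF t6, of "t powi (8 - 4 * i)"] assms(2)
      unfolding 1 2 h_eq [symmetric] by simp
  qed
  \<comment> \<open>For \<open>i = 0\<close> and \<open>i = 1\<close> the parameters are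
    \<open>t ^ 8\<close>, \<open>t ^ 4\<close> in either order. Their common value is the factor
    \<open>H\<close> that the second triple product introduced, so \<open>H\<close> cancels at the
    end.\<close>
  have H_eq: "H = qpoch_inf (t ^ 4) (t ^ 12) * qpoch_inf (t ^ 8) (t ^ 12) * qpoch_inf (t ^ 12) (t ^ 12)"
    unfolding H_def
    by (subst qpoch_inf_trisect[OF pp]) (simp add: p_def flip: power_mult power_add)
  have h0: "(h 0 has_sum H) UNIV" and h1: "(h 1 has_sum H) UNIV"
    using h_sum[of 0] h_sum[of 1] by (simp_all add: H_eq mult_ac)
  \<comment> \<open>At \<open>i = 2\<close> the parameter \<open>t powi (8 - 4 * i)\<close> is 1,
    and the product has a zero factor.\<close>
  have "qpoch_inf 1 (t ^ 12) = 0"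
    using qpoch_inf_split[of "t ^ 12" 1 1] assms(1)
    by (simp add: norm_power power_less_one_iff qpoch_Suc)
  then have h2: "(h 2 has_sum 0) UNIV"
    using h_sum[of 2] by simp

  define g where "g i k = (- 1) powi i * t powi (3 * k ^ 2 + (2 * i - 1) * k + i * (i - 1)) * z powi (3 * k + i)"
    for i k :: int
  define \<phi> where "\<phi> i = (\<lambda>(k, l). (k - 2 * l + i, k + l))" for i :: int
  \<comment> \<open>The substitution diagonalizes the quadratic form
    \<open>n ^ 2 + 2 * m ^ 2\<close>: its mixed terms in \<open>k * l\<close> cancel. Moreover
    \<open>n + 2 * m = 3 * k + i\<close> is free of \<open>l\<close>, so \<open>z\<close> does not
    enter the inner sum.\<close>
  have f_\<phi>: "f (\<phi> i (k, l)) = g i k * h i l" for i k l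
  proof -
    define n m where "n = k - 2 * l + i" and "m = k + l"
    have "(- 1 :: complex) powi n * (- 1) powi m = (- 1) powi i * (- 1) powi l"
    proof -
      have "n + m = (k + k) + (i + l) - (l + l)"
        by (simp add: n_def m_def)
      then show ?thesis
        unfolding minus_one_powi_add [symmetric]
        by (simp only: minus_one_powi_add minus_one_powi_diff minus_one_powi_double mult_1_left mult_1_right)
    qed
    moreover have "p powi (m * (m - 1)) * (p * z ^ 2) powi m = t powi (2 * m ^ 2) * z powi (2 * m)"
    proof -
      have "p powi (m * (m - 1)) * (p * z ^ 2) powi m = t powi (2 * (m * (m - 1))) * (t powi (2 * m) * z powi (2 * m))"
        by (simp add: p_def power_int_mult_distrib power_int_mult)
      also have "\<dots> = t powi (2 * m ^ 2) * z powi (2 * m)"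
        unfolding mult.assoc [symmetric] power_int_add[OF disjI1[OF assms(2)], symmetric]
        by (simp add: power2_eq_square algebra_simps)
      finally show ?thesis .
    qed
    moreover have "z powi n * z powi (2 * m) = z powi (3 * k + i)"
      using assms(3) by (simp flip: power_int_add) (simp add: n_def m_def)
    moreover have "t powi (n * (n - 1)) * t powi (2 * m ^ 2)
      = t powi (3 * k ^ 2 + (2 * i - 1) * k + i * (i - 1)) * t powi (6 * l ^ 2 + (2 - 4 * i) * l)"
      unfolding power_int_add[OF disjI1[OF assms(2)], symmetric] n_def m_def
      by (simp add: power2_eq_square algebra_simps)
    moreover have "f (\<phi> i (k, l)) = ((- 1) powi n * (- 1) powi m)
        * t powi (n * (n - 1)) * z powi n * (p powi (m * (m - 1)) * (p * z ^ 2) powi m)"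
      by (simp add: f_def \<phi>_def n_def m_def mult_ac)
    ultimately show ?thesis
      unfolding g_def h_def by algebra
  qed
  have inj: "inj (\<phi> i)" for i
    by (auto simp: inj_def \<phi>_def)
  have range: "range (\<phi> i) = {(n, m). (n - m) mod 3 = i}" if "i \<in> {0..<3}" for i
  proof (intro equalityI subsetI)
    fix x assume "x \<in> range (\<phi> i)"
    then obtain k l where "x = (k - 2 * l + i, k + l)"
      by (auto simp: \<phi>_def)
    then show "x \<in> {(n, m). (n - m) mod 3 = i}"
      using that by simp presburger
  next
    fix x :: "int \<times> int" assume "x \<in> {(n, m). (n - m) mod 3 = i}"
    then obtain n m where x: "x = (n, m)" "(n - m) mod 3 = i"
      by auto
    define l where "l = - ((n - m) div 3)"
    have "n - m = - 3 * l + i"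
      unfolding l_def using x(2) by presburger
    then have "x = \<phi> i (m - l, l)"
      by (simp add: \<phi>_def x(1))
    then show "x \<in> range (\<phi> i)" by blast
  qed
  have f_summable: "f summable_on A" for A
    using f_sum by (meson has_sum_imp_summable subset_UNIV summable_on_subset_banach)
  define S where "S i = infsum f (range (\<phi> i))" for i
  have S: "(f has_sum S i) (range (\<phi> i))" for i
    unfolding S_def by (intro has_sum_infsum f_summable)
  have g_sum: "((\<lambda>k. g i k * c) has_sum S i) UNIV" if "(h i has_sum c) UNIV" for i c
  proof -
    have "((f \<circ> \<phi> i) has_sum S i) (UNIV \<times> UNIV)"
      using S[of i] unfolding has_sum_reindex[OF inj] by simp
    then show ?thesis
    proof (rule has_sum_SigmaD)
      show "((\<lambda>l. (f \<circ> \<phi> i) (k, l)) has_sum g i k * c) UNIV" for k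
        unfolding o_def f_\<phi> by (rule has_sum_cmult_right[OF that])
    qed
  qed
  have "(f has_sum (S 0 + S 1 + S 2)) (range (\<phi> 0) \<union> range (\<phi> 1) \<union> range (\<phi> 2))"
    by (intro has_sum_Un_disjoint S) (auto simp: range)
  moreover have "range (\<phi> 0) \<union> range (\<phi> 1) \<union> range (\<phi> 2) = UNIV"
  proof -
    have "x \<in> range (\<phi> ((fst x - snd x) mod 3))" for x
      by (subst range) (auto simp: case_prod_unfold)
    moreover have "(fst x - snd x) mod 3 \<in> {0, 1, 2}" for x :: "int \<times> int"
      by simp presburger
    ultimately have "x \<in> range (\<phi> 0) \<union> range (\<phi> 1) \<union> range (\<phi> 2)" for x
      by (metis Un_iff empty_iff insert_iff)
    then show ?thesis by blast
  qed
  ultimately have "S 0 + S 1 + S 2 = J1 * (J2 * H)"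
    using f_sum by (metis has_sum_unique)
  moreover have "S 2 = 0"
    using g_sum[OF h2] has_sum_0_simp by (metis (no_types, lifting) has_sum_cong has_sum_unique mult_zero_right)
  ultimately have S01: "S 0 + S 1 = J1 * (J2 * H)"
    by simp
  have g0: "(g 0 has_sum (S 0 / H)) UNIV" and g1: "(g 1 has_sum (S 1 / H)) UNIV"
    using has_sum_divide_const[OF g_sum[OF h0], of H] has_sum_divide_const[OF g_sum[OF h1], of H] H0 by simp_all
  have g0': "((\<lambda>k. t powi (3 * k ^ 2 - k) * z powi (3 * k)) has_sum (S 0 / H)) UNIV"
    using g0 by (simp add: g_def [abs_def])
  have g1': "((\<lambda>k. t powi (3 * k ^ 2 + k) * z powi (3 * k + 1)) has_sum (- (S 1 / H))) UNIV"
    using has_sum_uminusI[OF g1] by (simp add: g_def [abs_def])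
  show "(\<lambda>k. t powi (3 * k ^ 2 - k) * z powi (3 * k)) summable_on UNIV"
    and "(\<lambda>k. t powi (3 * k ^ 2 + k) * z powi (3 * k + 1)) summable_on UNIV"
    using g0' g1' by (auto intro: has_sum_imp_summable)
  have "S 0 / H - - (S 1 / H) = J1 * J2"
    using S01 H0 by (simp add: field_simps)
  then show "(\<Sum>\<^sub>\<infinity>k. t powi (3 * k ^ 2 - k) * z powi (3 * k))
       - (\<Sum>\<^sub>\<infinity>k. t powi (3 * k ^ 2 + k) * z powi (3 * k + 1))
       = qpoch_inf z p * qpoch_inf (p / z) p * qpoch_inf p p
         * qpoch_inf (p * z ^ 2) (p ^ 2) * qpoch_inf (p / z ^ 2) (p ^ 2)"
    unfolding infsumI[OF g0'] infsumI[OF g1'] J1_def J2_def by (simp add: mult_ac)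
qed

section \<open>Finite identities for Gaussian binomials\<close>

text \<open>The integer lower index together with \<open>rpoch\<close> gives the value 0 outside the
  range from 0 to \<open>N\<close>, so bilateral sums have finite support and no index subtraction
  is truncated.\<close>

definition gbinom :: "complex \<Rightarrow> nat \<Rightarrow> int \<Rightarrow> complex" where
  "gbinom p N k = qpoch p p N * rpoch p (int N - k) * rpoch p k"

lemma gbinom_eq_0: "k < 0 \<or> k > int N \<Longrightarrow> gbinom p N k = 0"
  by (auto simp: gbinom_def)

lemma gbinom_0_0 [simp]: "gbinom p 0 0 = 1"
  by (simp add: gbinom_def rpoch_def)

lemma gbinom_flip: "k + l = int N \<Longrightarrow> gbinom p N k = gbinom p N l"
  by (simp add: gbinom_def mult_ac flip: eq_diff_eq eq_diff_eq' diff_eq_eq)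

text \<open>After both sides are put over the larger reciprocals, this is \<open>1 - p ^ (N + 1) =
  (1 - p powi k) + p powi k * (1 - p powi (N + 1 - k))\<close>.\<close>

lemma gbinom_Suc:
  assumes "norm p < 1" "p \<noteq> 0"
  shows "gbinom p (Suc N) k = gbinom p N (k - 1) + p powi k * gbinom p N k"
proof -
  have 1: "rpoch p (k - 1) = (1 - p powi k) * rpoch p k"
    by (rule rpoch_minus_1[OF assms(1)])
  have "rpoch p (int N + 1 - k - 1) = (1 - p powi (int N + 1 - k)) * rpoch p (int N + 1 - k)"
    by (rule rpoch_minus_1[OF assms(1)])
  then have 2: "rpoch p (int N - k) = (1 - p powi (int N + 1 - k)) * rpoch p (int N + 1 - k)"
    by (simp add: algebra_simps)
  have 3: "p powi k * p powi (int N + 1 - k) = p * p ^ N"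
    using assms(2) by (simp flip: power_int_add) (simp add: power_int_add)
  have "int N - (k - 1) = int N + 1 - k" "int (Suc N) - k = int N + 1 - k"
    by simp_all
  then show ?thesis
    unfolding gbinom_def 1 2 qpoch_Suc by (simp only: 3 [symmetric]) (simp only: ring_distribs mult_ac mult_1_left mult_1_right, simp)
qed

lemma gbinom_Suc':
  assumes "norm p < 1" "p \<noteq> 0"
  shows "gbinom p (Suc N) k = p powi (int N + 1 - k) * gbinom p N (k - 1) + gbinom p N k"
proof -
  have "gbinom p (Suc N) k = gbinom p (Suc N) (int N + 1 - k)"
    by (rule gbinom_flip) simp
  also have "\<dots> = gbinom p N (int N - k) + p powi (int N + 1 - k) * gbinom p N (int N + 1 - k)"
    by (subst gbinom_Suc[OF assms]) simp
  also have "gbinom p N (int N - k) = gbinom p N k"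
    by (rule gbinom_flip) simp
  also have "gbinom p N (int N + 1 - k) = gbinom p N (k - 1)"
    by (rule gbinom_flip) simp
  finally show ?thesis by simp
qed

lemma has_sum_reflect_diff:
  fixes h :: "int \<Rightarrow> complex"
  assumes "h summable_on UNIV"
  shows "((\<lambda>r. h r - h (c - r)) has_sum 0) UNIV"
proof -
  have h: "(h has_sum infsum h UNIV) UNIV"
    using assms by (rule has_sum_infsum)
  have "bij_betw (\<lambda>r. c - r) UNIV UNIV"
    by (rule bij_betwI[of _ _ _ "\<lambda>r. c - r"]) auto
  from has_sum_reindex_bij_betw[OF this, THEN iffD2, OF h]
  have "((\<lambda>r. h (c - r)) has_sum infsum h UNIV) UNIV" .
  from has_sum_add[OF h has_sum_uminusI[OF this]] show ?thesis
    by simp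
qed

text \<open>The extra terms produced by the Pascal rules below have exactly this antisymmetric shape
  under \<open>r\<close> to \<open>c - r\<close>, for a suitable \<open>c\<close>, and hence do not
  affect the sum.\<close>

lemma gbinom_reflect_has_sum_0:
  "((\<lambda>r. a r * gbinom p N (b - 3 * r) - a (c - r) * gbinom p N (b - 3 * (c - r))) has_sum 0) UNIV"
proof (rule has_sum_reflect_diff)
  have "b - 3 * r < 0 \<or> b - 3 * r > int N" if "r \<notin> {- \<bar>b\<bar> - int N..\<bar>b\<bar> + int N}" for r
    using that by auto
  then have "((\<lambda>r. a r * gbinom p N (b - 3 * r)) has_sum
      (\<Sum>r\<in>{- \<bar>b\<bar> - int N..\<bar>b\<bar> + int N}. a r * gbinom p N (b - 3 * r))) UNIV"
    by (intro has_sum_finite_neutralI[OF _ _ _ refl]) (auto simp: gbinom_eq_0)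
  then show "(\<lambda>r. a r * gbinom p N (b - 3 * r)) summable_on UNIV"
    by (rule has_sum_imp_summable)
qed

section \<open>Alternating sums of Gaussian binomials with step 3\<close>

text \<open>Setting \<open>p = 1\<close> formally gives the reflection-principle count of closed
  paths with 2n steps up or down confined to a strip of two adjacent heights. There is exactly one
  such path, which matches the value 1 proved below; \<open>strip_odd\<close> plays the same role
  for 2n + 1 steps.\<close>

definition strip_even :: "complex \<Rightarrow> nat \<Rightarrow> int \<Rightarrow> complex" where
  "strip_even p n r = p powi (6 * r ^ 2 + r) * gbinom p (2 * n) (int n - 3 * r)
     - p powi (6 * r ^ 2 + 5 * r + 1) * gbinom p (2 * n) (int n - 3 * r - 1)"

definition strip_odd :: "complex \<Rightarrow> nat \<Rightarrow> int \<Rightarrow> complex" where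
  "strip_odd p n r = p powi (6 * r ^ 2 + r) * gbinom p (2 * n + 1) (int n - 3 * r)
     - p powi (6 * r ^ 2 + 5 * r + 1) * gbinom p (2 * n + 1) (int n - 3 * r - 1)"

context
  fixes p :: complex
  assumes p: "norm p < 1" "p \<noteq> 0"
begin

lemma powi_merge: "p powi a * (p powi b * x) = p powi (a + b) * x"
  using p(2) by (simp add: power_int_add)

text \<open>Expand both binomials by \<open>gbinom_Suc'\<close>: the terms without a new power of
  \<open>p\<close> rebuild \<open>strip_even\<close>, and the other two are exchanged by the
  reflection \<open>r\<close> to \<open>- 1 - r\<close>.\<close>

lemma strip_odd_step:
  assumes "(strip_even p n has_sum S) UNIV"
  shows "(strip_odd p n has_sum S) UNIV"
proof -
  define a where "a r = p powi (6 * r ^ 2 + 4 * r + int n + 1)" for r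
  have "strip_odd p n r = strip_even p n r + (a r * gbinom p (2 * n) (int n - 1 - 3 * r)
      - a (- 1 - r) * gbinom p (2 * n) (int n - 1 - 3 * (- 1 - r)))" for r
  proof -
    have 1: "gbinom p (2 * n + 1) (int n - 3 * r)
        = p powi (int n + 3 * r + 1) * gbinom p (2 * n) (int n - 1 - 3 * r) + gbinom p (2 * n) (int n - 3 * r)"
      using gbinom_Suc'[OF p, of "2 * n" "int n - 3 * r"] by (simp add: algebra_simps)
    have 2: "gbinom p (2 * n + 1) (int n - 3 * r - 1)
        = p powi (int n + 3 * r + 2) * gbinom p (2 * n) (int n - 3 * r - 2) + gbinom p (2 * n) (int n - 3 * r - 1)"
      using gbinom_Suc'[OF p, of "2 * n" "int n - 3 * r - 1"] by (simp add: algebra_simps)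
    have 3: "gbinom p (2 * n) (int n - 1 - 3 * (- 1 - r)) = gbinom p (2 * n) (int n - 3 * r - 2)"
      by (rule gbinom_flip) simp
    show ?thesis
      unfolding strip_odd_def strip_even_def 1 2 3 a_def
      unfolding ring_distribs powi_merge
      by (simp add: power2_eq_square algebra_simps)
  qed
  from this [symmetric] show ?thesis
    using has_sum_add[OF assms gbinom_reflect_has_sum_0[of a p "2 * n" "int n - 1" "- 1"]]
    by (simp only: add_0_right)
qed

text \<open>Here the other Pascal rule, \<open>gbinom_Suc\<close>, is the one that works: the
  unweighted terms rebuild \<open>strip_odd\<close>, and the weighted ones pair up under
  \<open>r\<close> to \<open>- r\<close>.\<close>

lemma strip_even_step:
  assumes "(strip_odd p n has_sum S) UNIV"
  shows "(strip_even p (Suc n) has_sum S) UNIV"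
proof -
  define a where "a r = p powi (6 * r ^ 2 - 2 * r + int n + 1)" for r
  have "strip_even p (Suc n) r = strip_odd p n r + (a r * gbinom p (2 * n + 1) (int n + 1 - 3 * r)
      - a (0 - r) * gbinom p (2 * n + 1) (int n + 1 - 3 * (0 - r)))" for r
  proof -
    have 1: "gbinom p (2 * Suc n) (int (Suc n) - 3 * r)
        = gbinom p (2 * n + 1) (int n - 3 * r) + p powi (int n + 1 - 3 * r) * gbinom p (2 * n + 1) (int n + 1 - 3 * r)"
      using gbinom_Suc[OF p, of "2 * n + 1" "int n + 1 - 3 * r"] by (simp add: algebra_simps)
    have 2: "gbinom p (2 * Suc n) (int (Suc n) - 3 * r - 1)
        = gbinom p (2 * n + 1) (int n - 3 * r - 1) + p powi (int n - 3 * r) * gbinom p (2 * n + 1) (int n - 3 * r)"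
      using gbinom_Suc[OF p, of "2 * n + 1" "int n - 3 * r"] by (simp add: algebra_simps)
    have 3: "gbinom p (2 * n + 1) (int n + 1 - 3 * (0 - r)) = gbinom p (2 * n + 1) (int n - 3 * r)"
      by (rule gbinom_flip) simp
    show ?thesis
      unfolding strip_odd_def strip_even_def 1 2 3 a_def
      unfolding ring_distribs powi_merge
      by (simp add: power2_eq_square algebra_simps)
  qed
  from this [symmetric] show ?thesis
    using has_sum_add[OF assms gbinom_reflect_has_sum_0[of a p "2 * n + 1" "int n + 1" 0]]
    by (simp only: add_0_right)
qed

lemma strip_even_has_sum: "(strip_even p n has_sum 1) UNIV"
proof (induction n)
  case 0
  show ?case
  proof (rule has_sum_finite_neutralI[of "{0}"])
    show "strip_even p 0 r = 0" if "r \<in> UNIV - {0}" for r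
      using that by (cases "r < 0") (auto simp: strip_even_def gbinom_eq_0)
  qed (auto simp: strip_even_def gbinom_eq_0)
next
  case (Suc n)
  then show ?case
    by (intro strip_even_step strip_odd_step)
qed

lemma strip_odd_has_sum: "(strip_odd p n has_sum 1) UNIV"
  by (intro strip_odd_step strip_even_has_sum)

text \<open>Opposite Pascal rules are applied to the two binomials, so that their common term
  cancels. What is left is \<open>p ^ n\<close> times a summand of \<open>strip_odd\<close>, up to
  an antisymmetric pair. The case \<open>n = 0\<close> is separate because the rules lower the upper
  index \<open>2 * n\<close>.\<close>

lemma strip_even_shifted_has_sum:
  "((\<lambda>r. p powi (6 * r ^ 2 + 2 * r) * gbinom p (2 * n) (int n - 3 * r)
     - p powi (6 * r ^ 2 + 2 * r) * gbinom p (2 * n) (int n - 3 * r - 1)) has_sum p ^ n) UNIV"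
proof (cases n)
  case 0
  show ?thesis
    unfolding 0
  proof (rule has_sum_finite_neutralI[of "{0}"])
    show "p powi (6 * r ^ 2 + 2 * r) * gbinom p (2 * 0) (int 0 - 3 * r)
     - p powi (6 * r ^ 2 + 2 * r) * gbinom p (2 * 0) (int 0 - 3 * r - 1) = 0" if "r \<in> UNIV - {0}" for r
      using that by (cases "r < 0") (auto simp: gbinom_eq_0)
  qed (auto simp: gbinom_eq_0)
next
  case (Suc m)
  define a where "a r = p powi (6 * r ^ 2 - r)" for r
  have "p powi (6 * r ^ 2 + 2 * r) * gbinom p (2 * n) (int n - 3 * r)
      - p powi (6 * r ^ 2 + 2 * r) * gbinom p (2 * n) (int n - 3 * r - 1)
      = p ^ n * (strip_odd p m r + (a r * gbinom p (2 * m + 1) (int m + 1 - 3 * r)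
          - a (0 - r) * gbinom p (2 * m + 1) (int m + 1 - 3 * (0 - r))))" for r
  proof -
    have 1: "gbinom p (2 * n) (int n - 3 * r)
        = gbinom p (2 * m + 1) (int m - 3 * r) + p powi (int m + 1 - 3 * r) * gbinom p (2 * m + 1) (int m + 1 - 3 * r)"
      using gbinom_Suc[OF p, of "2 * m + 1" "int m + 1 - 3 * r"] by (simp add: algebra_simps Suc)
    have 2: "gbinom p (2 * n) (int n - 3 * r - 1)
        = p powi (int m + 3 * r + 2) * gbinom p (2 * m + 1) (int m - 3 * r - 1) + gbinom p (2 * m + 1) (int m - 3 * r)"
      using gbinom_Suc'[OF p, of "2 * m + 1" "int m - 3 * r"] by (simp add: algebra_simps Suc)
    have 3: "gbinom p (2 * m + 1) (int m + 1 - 3 * (0 - r)) = gbinom p (2 * m + 1) (int m - 3 * r)"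
      by (rule gbinom_flip) simp
    have 4: "p ^ n = p powi (int m + 1)"
      unfolding Suc by (subst power_int_of_nat [symmetric]) (simp add: add.commute)
    show ?thesis
      unfolding strip_odd_def 1 2 3 4 a_def
      unfolding ring_distribs powi_merge
      by (simp add: power2_eq_square algebra_simps)
  qed
  then show ?thesis
    using has_sum_cmult_right[OF has_sum_add[OF strip_odd_has_sum[of m]
        gbinom_reflect_has_sum_0[of a p "2 * m + 1" "int m + 1" 0]], of "p ^ n"]
    by simp
qed

text \<open>Again opposite Pascal rules cancel the middle binomial; the remainder is
  \<open>p ^ n\<close> times a summand of \<open>strip_even\<close>, up to a pair exchanged by
  \<open>r\<close> to \<open>- 1 - r\<close>.\<close>

lemma strip_odd_shifted_has_sum:
  "((\<lambda>r. p powi (6 * r ^ 2 + 4 * r) * gbinom p (2 * n + 1) (int n - 3 * r)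
     - p powi (6 * r ^ 2 + 4 * r) * gbinom p (2 * n + 1) (int n - 3 * r - 1)) has_sum p ^ n) UNIV"
proof -
  define a where "a r = p powi (6 * r ^ 2 + 5 * r + 1)" for r
  have "p powi (6 * r ^ 2 + 4 * r) * gbinom p (2 * n + 1) (int n - 3 * r)
      - p powi (6 * r ^ 2 + 4 * r) * gbinom p (2 * n + 1) (int n - 3 * r - 1)
      = p ^ n * (strip_even p n r + (a r * gbinom p (2 * n) (int n - 1 - 3 * r)
          - a (- 1 - r) * gbinom p (2 * n) (int n - 1 - 3 * (- 1 - r))))" for r
  proof -
    have 1: "gbinom p (2 * n + 1) (int n - 3 * r)
        = gbinom p (2 * n) (int n - 3 * r - 1) + p powi (int n - 3 * r) * gbinom p (2 * n) (int n - 3 * r)"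
      using gbinom_Suc[OF p, of "2 * n" "int n - 3 * r"] by (simp add: algebra_simps)
    have 2: "gbinom p (2 * n + 1) (int n - 3 * r - 1)
        = p powi (int n + 3 * r + 2) * gbinom p (2 * n) (int n - 3 * r - 2) + gbinom p (2 * n) (int n - 3 * r - 1)"
      using gbinom_Suc'[OF p, of "2 * n" "int n - 3 * r - 1"] by (simp add: algebra_simps)
    have 3: "gbinom p (2 * n) (int n - 1 - 3 * (- 1 - r)) = gbinom p (2 * n) (int n - 3 * r - 2)"
      by (rule gbinom_flip) simp
    have 4: "p ^ n = p powi int n"
      by simp
    show ?thesis
      unfolding strip_even_def 1 2 3 4 a_def
      unfolding ring_distribs powi_merge
      by (simp add: power2_eq_square algebra_simps)
  qed
  then show ?thesis
    using has_sum_cmult_right[OF has_sum_add[OF strip_even_has_sum[of n]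
        gbinom_reflect_has_sum_0[of a p "2 * n" "int n - 1" "- 1"]], of "p ^ n"]
    by simp
qed

end

section \<open>From finite identities to theta series\<close>

lemma has_sum_nat_shift:
  fixes g :: "nat \<Rightarrow> 'a :: {comm_monoid_add, topological_space}"
  assumes "\<And>k. k < K \<Longrightarrow> g k = 0"
  shows "(g has_sum S) UNIV \<longleftrightarrow> ((\<lambda>n. g (K + n)) has_sum S) UNIV"
proof -
  have "bij_betw (\<lambda>n. K + n) UNIV {K..}"
    by (rule bij_betwI[of _ _ _ "\<lambda>k. k - K"]) auto
  then have "((\<lambda>n. g (K + n)) has_sum S) UNIV \<longleftrightarrow> (g has_sum S) {K..}"
    by (rule has_sum_reindex_bij_betw)
  also have "\<dots> \<longleftrightarrow> (g has_sum S) UNIV"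
    using assms by (intro has_sum_cong_neutral) auto
  finally show ?thesis by simp
qed

text \<open>Convergence is read off the triple product with \<open>t = q ^ a\<close> and
  \<open>z = q powi (a + b)\<close>; its alternating signs disappear on taking norms.\<close>

lemma summable_powi_quadratic:
  fixes q :: complex and a b c :: int
  assumes "norm q < 1" "q \<noteq> 0" "a > 0"
  shows "(\<lambda>r. q powi (a * r ^ 2 + b * r + c)) summable_on UNIV"
    and "(\<lambda>r. norm (q powi (a * r ^ 2 + b * r + c))) summable_on UNIV"
proof -
  define f where "f r = (- 1) powi r * (q ^ nat a) powi (r * (r - 1)) * (q powi (a + b)) powi r" for r
  have eq: "f r = (- 1) powi r * q powi (a * r ^ 2 + b * r)" for r
  proof -
    have "(q ^ nat a) powi (r * (r - 1)) * (q powi (a + b)) powi r = q powi (a * r ^ 2 + b * r)"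
      unfolding power_int_power power_int_mult [symmetric] power_int_add[OF disjI1[OF assms(2)], symmetric]
      using assms(3) by (simp add: power2_eq_square algebra_simps)
    then show ?thesis
      by (simp add: f_def mult.assoc)
  qed
  have "norm (q ^ nat a) < 1"
    using assms by (simp add: norm_power power_less_one_iff)
  then have "f summable_on UNIV"
    using jacobi_triple_product[of "q ^ nat a" "q powi (a + b)"] assms(2)
    unfolding f_def by (auto intro: has_sum_imp_summable)
  then have "(\<lambda>r. norm (f r)) summable_on UNIV"
    by (simp add: summable_on_iff_abs_summable_on_complex)
  from summable_on_cmult_right[OF this, of "norm (q powi c)"]
  show *: "(\<lambda>r. norm (q powi (a * r ^ 2 + b * r + c))) summable_on UNIV"
    using assms(2) by (simp add: eq norm_mult norm_power_int power_int_add mult_ac)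
  show "(\<lambda>r. q powi (a * r ^ 2 + b * r + c)) summable_on UNIV"
    by (rule abs_summable_summable[OF *])
qed

lemma summable_qpoch_gaussian:
  fixes q :: complex
  assumes "norm q < 1"
  shows "(\<lambda>n. norm (qpoch (- q) (q ^ 2) (n + e) * q ^ n ^ 2)) summable_on UNIV"
proof -
  have p: "norm (q ^ 2) < 1"
    by (rule norm_sq_less_1[OF assms])
  obtain K where K: "K > 0" "\<And>n. norm (qpoch (- q) (q ^ 2) n) \<le> K"
    using qpoch_bounded[OF p] by blast
  have "summable (\<lambda>n. K * (norm q ^ n * norm q ^ (n * (n - 1))))"
    using assms by (intro summable_mult summable_gaussian) auto
  moreover have "norm q ^ n * norm q ^ (n * (n - 1)) = norm q ^ n ^ 2" for n
    by (cases n) (simp_all add: power2_eq_square flip: power_add)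
  ultimately have "summable (\<lambda>n. K * norm q ^ n ^ 2)"
    by simp
  then have "(\<lambda>n. K * norm q ^ n ^ 2) summable_on UNIV"
    using K by (subst summable_on_UNIV_nonneg_real_iff) auto
  then show ?thesis
    by (rule summable_on_comparison_test) (use K in \<open>auto simp: norm_mult norm_power intro!: mult_right_mono\<close>)
qed

lemma rpoch_bounded:
  assumes "norm p < 1"
  obtains K where "K > 0" "\<And>k. norm (rpoch p k) \<le> K"
proof -
  obtain K where K: "K > 0" "\<And>n. norm (inverse (qpoch p p n)) \<le> K"
    using inverse_qpoch_bounded[OF assms, of p] power_neq_1[OF assms, of "Suc _"] by auto
  have "norm (rpoch p k) \<le> K" for k
    using K(1) K(2)[of "nat k"] by (auto simp: rpoch_def divide_inverse)
  then show ?thesis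
    using that K(1) by blast
qed

definition qprod_ratio :: "complex \<Rightarrow> complex" where
  "qprod_ratio q = qpoch_inf (- q) (q ^ 2) / qpoch_inf (q ^ 2) (q ^ 2)"

section \<open>The inner sums over n\<close>

text \<open>The terms with \<open>n < r\<close> vanish. Putting \<open>n = r + k\<close> gives the
  q-Gauss sum of \<open>rpoch_gauss_has_sum\<close> with \<open>N = 2 * r\<close>, multiplied by the
  weight at \<open>n = r\<close>.\<close>

lemma even_kernel_nat:
  fixes q :: complex and r :: nat
  assumes "norm q < 1"
  shows "((\<lambda>n. qpoch (- q) (q ^ 2) n * q ^ n ^ 2
      * (rpoch (q ^ 2) (int n - int r) * rpoch (q ^ 2) (int n + int r)))
    has_sum q ^ r ^ 2 * qprod_ratio q) UNIV"
proof -
  define p where "p = q ^ 2"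
  have p: "norm p < 1"
    unfolding p_def by (rule norm_sq_less_1[OF assms])
  \<comment> \<open>The first parameter that remains after splitting off
    \<open>qpoch (- q) p r\<close>. The two pieces recombine to \<open>qpoch_inf (- q) p\<close>, so
    the value depends on \<open>r\<close> only through \<open>q ^ r ^ 2\<close>.\<close>
  define x where "x = - (q ^ (2 * r + 1))"
  have *: "qpoch (- q) p (r + k) * q ^ (r + k) ^ 2 = qpoch (- q) p r * q ^ r ^ 2
      * ((- 1) ^ k * q ^ (k * (k - 1)) * (\<Prod>j<k. x - q ^ (2 * (2 * r) + 2 + 2 * j)))" for k
  proof (induction k)
    case (Suc k)
    have "Suc k * (Suc k - 1) = k * (k - 1) + 2 * k"
      by (cases k) (simp_all add: algebra_simps)
    then have 1: "q ^ (Suc k * (Suc k - 1)) = q ^ (k * (k - 1)) * q ^ (2 * k)"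
      by (simp only: power_add)
    have 2: "q ^ (r + Suc k) ^ 2 = q ^ (r + k) ^ 2 * q ^ (2 * r + 2 * k + 1)"
    proof -
      have "(r + Suc k) ^ 2 = (r + k) ^ 2 + (2 * r + 2 * k + 1)"
        by (simp add: power2_eq_square algebra_simps)
      then show ?thesis
        by (simp only: power_add)
    qed
    have "q ^ (2 * (2 * r) + 2 + 2 * k) = q ^ (2 * r + 1) * (q * p ^ (r + k))"
      unfolding p_def power_mult [symmetric] power_Suc [symmetric] power_add [symmetric] by simp
    moreover have "q ^ (2 * r + 2 * k + 1) = q ^ (2 * k) * q ^ (2 * r + 1)"
      unfolding power_add [symmetric] by (simp add: add_ac)
    ultimately have 3: "- (q ^ (2 * k)) * (x - q ^ (2 * (2 * r) + 2 + 2 * k)) = q ^ (2 * r + 2 * k + 1) * (1 + q * p ^ (r + k))"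
      unfolding x_def by (simp only:) (simp add: ring_distribs)
    have "qpoch (- q) p (r + Suc k) * q ^ (r + Suc k) ^ 2
        = (qpoch (- q) p (r + k) * q ^ (r + k) ^ 2) * (q ^ (2 * r + 2 * k + 1) * (1 + q * p ^ (r + k)))"
      unfolding 2 by (simp add: qpoch_Suc)
    also have "\<dots> = qpoch (- q) p r * q ^ r ^ 2
      * ((- 1) ^ Suc k * q ^ (Suc k * (Suc k - 1)) * (\<Prod>j<Suc k. x - q ^ (2 * (2 * r) + 2 + 2 * j)))"
      unfolding Suc.IH 3 [symmetric] 1 by simp
    finally show ?case .
  qed simp
  have "qpoch_inf (- q) p = qpoch (- q) p r * qpoch_inf x p"
    by (subst qpoch_inf_split[OF p, of _ r]) (simp add: x_def p_def flip: power_mult)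
  then have val: "q ^ r ^ 2 * qprod_ratio q = qpoch (- q) p r * q ^ r ^ 2 * (qpoch_inf x p / qpoch_inf p p)"
    by (simp add: qprod_ratio_def p_def)
  have idx: "int (r + k) - int r = int k" "int (r + k) + int r = int k + int (2 * r)" for k
    by simp_all
  have "qpoch (- q) p (r + k) * q ^ (r + k) ^ 2
      * (rpoch p (int (r + k) - int r) * rpoch p (int (r + k) + int r))
    = qpoch (- q) p (r) * q ^ r ^ 2 * ((- 1) ^ k * q ^ (k * (k - 1))
      * (\<Prod>j<k. x - q ^ (2 * (2 * r) + 2 + 2 * j)) * rpoch p (int k) * rpoch p (int k + int (2 * r)))" for k
    unfolding * idx by (simp only: mult.assoc)
  then have "((\<lambda>k. qpoch (- q) p (r + k) * q ^ (r + k) ^ 2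
      * (rpoch p (int (r + k) - int r) * rpoch p (int (r + k) + int r))) has_sum
      qpoch (- q) p (r) * q ^ r ^ 2 * (qpoch_inf x p / qpoch_inf p p)) UNIV"
    using has_sum_cmult_right[OF rpoch_gauss_has_sum[OF assms, of x "2 * r"], of "qpoch (- q) p (r) * q ^ r ^ 2"]
    by (simp only: p_def [symmetric])
  then show ?thesis
    unfolding p_def [symmetric] val by (subst has_sum_nat_shift[of r]) auto
qed

text \<open>As in the even case but with \<open>N = 2 * r + 1\<close>. The weight at
  \<open>n = r\<close> now contains one factor more than the splitting of
  \<open>qpoch_inf (- q) p\<close> absorbs, which leaves \<open>1 + q ^ (2 * r + 1)\<close>.\<close>

lemma odd_kernel_nat:
  fixes q :: complex and r :: nat
  assumes "norm q < 1"
  shows "((\<lambda>n. qpoch (- q) (q ^ 2) (n + 1) * q ^ n ^ 2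
      * (rpoch (q ^ 2) (int n - int r) * rpoch (q ^ 2) (int n + int r + 1)))
    has_sum q ^ r ^ 2 * (1 + q ^ (2 * r + 1)) * qprod_ratio q) UNIV"
proof -
  define p where "p = q ^ 2"
  have p: "norm p < 1"
    unfolding p_def by (rule norm_sq_less_1[OF assms])
  define x where "x = - (q ^ (2 * r + 1))"
  have *: "qpoch (- q) p (r + k + 1) * q ^ (r + k) ^ 2 = qpoch (- q) p (r + 1) * q ^ r ^ 2
      * ((- 1) ^ k * q ^ (k * (k - 1)) * (\<Prod>j<k. x - q ^ (2 * (2 * r + 1) + 2 + 2 * j)))" for k
  proof (induction k)
    case (Suc k)
    have "Suc k * (Suc k - 1) = k * (k - 1) + 2 * k"
      by (cases k) (simp_all add: algebra_simps)
    then have 1: "q ^ (Suc k * (Suc k - 1)) = q ^ (k * (k - 1)) * q ^ (2 * k)"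
      by (simp only: power_add)
    have 2: "q ^ (r + Suc k) ^ 2 = q ^ (r + k) ^ 2 * q ^ (2 * r + 2 * k + 1)"
    proof -
      have "(r + Suc k) ^ 2 = (r + k) ^ 2 + (2 * r + 2 * k + 1)"
        by (simp add: power2_eq_square algebra_simps)
      then show ?thesis
        by (simp only: power_add)
    qed
    have "q ^ (2 * (2 * r + 1) + 2 + 2 * k) = q ^ (2 * r + 1) * (q * p ^ (r + k + 1))"
      unfolding p_def power_mult [symmetric] power_Suc [symmetric] power_add [symmetric] by simp
    moreover have "q ^ (2 * r + 2 * k + 1) = q ^ (2 * k) * q ^ (2 * r + 1)"
      unfolding power_add [symmetric] by (simp add: add_ac)
    ultimately have 3: "- (q ^ (2 * k)) * (x - q ^ (2 * (2 * r + 1) + 2 + 2 * k)) = q ^ (2 * r + 2 * k + 1) * (1 + q * p ^ (r + k + 1))"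
      unfolding x_def by (simp only:) (simp add: ring_distribs)
    have "qpoch (- q) p (r + Suc k + 1) * q ^ (r + Suc k) ^ 2
        = (qpoch (- q) p (r + k + 1) * q ^ (r + k) ^ 2) * (q ^ (2 * r + 2 * k + 1) * (1 + q * p ^ (r + k + 1)))"
      unfolding 2 by (simp add: qpoch_Suc)
    also have "\<dots> = qpoch (- q) p (r + 1) * q ^ r ^ 2
      * ((- 1) ^ Suc k * q ^ (Suc k * (Suc k - 1)) * (\<Prod>j<Suc k. x - q ^ (2 * (2 * r + 1) + 2 + 2 * j)))"
      unfolding Suc.IH 3 [symmetric] 1 by simp
    finally show ?case .
  qed simp
  have "qpoch_inf (- q) p = qpoch (- q) p r * qpoch_inf x p"
    by (subst qpoch_inf_split[OF p, of _ r]) (simp add: x_def p_def flip: power_mult)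
  moreover have "qpoch (- q) p (r + 1) = qpoch (- q) p r * (1 + q ^ (2 * r + 1))"
    by (simp add: qpoch_Suc p_def flip: power_mult)
  ultimately have val: "q ^ r ^ 2 * (1 + q ^ (2 * r + 1)) * qprod_ratio q
      = qpoch (- q) p (r + 1) * q ^ r ^ 2 * (qpoch_inf x p / qpoch_inf p p)"
    by (simp add: qprod_ratio_def p_def mult_ac)
  have idx: "int (r + k) - int r = int k" "int (r + k) + int r + 1 = int k + int (2 * r + 1)" for k
    by simp_all
  have "qpoch (- q) p (r + k + 1) * q ^ (r + k) ^ 2
      * (rpoch p (int (r + k) - int r) * rpoch p (int (r + k) + int r + 1))
    = qpoch (- q) p (r + 1) * q ^ r ^ 2 * ((- 1) ^ k * q ^ (k * (k - 1))
      * (\<Prod>j<k. x - q ^ (2 * (2 * r + 1) + 2 + 2 * j)) * rpoch p (int k) * rpoch p (int k + int (2 * r + 1)))" for k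
    unfolding * idx by (simp only: mult.assoc)
  then have "((\<lambda>k. qpoch (- q) p (r + k + 1) * q ^ (r + k) ^ 2
      * (rpoch p (int (r + k) - int r) * rpoch p (int (r + k) + int r + 1))) has_sum
      qpoch (- q) p (r + 1) * q ^ r ^ 2 * (qpoch_inf x p / qpoch_inf p p)) UNIV"
    using has_sum_cmult_right[OF rpoch_gauss_has_sum[OF assms, of x "2 * r + 1"], of "qpoch (- q) p (r + 1) * q ^ r ^ 2"]
    by (simp only: p_def [symmetric])
  then show ?thesis
    unfolding p_def [symmetric] val by (subst has_sum_nat_shift[of r]) auto
qed

lemma even_kernel:
  fixes q :: complex and r :: int
  assumes "norm q < 1"
  shows "((\<lambda>n. qpoch (- q) (q ^ 2) n * q ^ n ^ 2 * (rpoch (q ^ 2) (int n - r) * rpoch (q ^ 2) (int n + r)))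
    has_sum q powi r ^ 2 * qprod_ratio q) UNIV"
proof (cases "r \<ge> 0")
  case True
  define s where "s = nat r"
  have r: "r = int s" using True by (simp add: s_def)
  have "q powi r ^ 2 = q ^ s ^ 2"
    unfolding r by (metis of_nat_power power_int_of_nat)
  then show ?thesis
    using even_kernel_nat[OF assms, of s] by (simp add: r)
next
  case False
  define s where "s = nat (- r)"
  have r: "r = - int s" using False by (simp add: s_def)
  have "q powi r ^ 2 = q ^ s ^ 2"
    unfolding r power2_minus by (metis of_nat_power power_int_of_nat)
  then show ?thesis
    using even_kernel_nat[OF assms, of s] by (simp add: r mult_ac)
qed

text \<open>Writing the value as a sum of two squares in the exponent displays the symmetry
  \<open>r\<close> to \<open>- r - 1\<close>, which also swaps the two \<open>rpoch\<close> factors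
  and so covers negative \<open>r\<close>.\<close>

lemma odd_kernel:
  fixes q :: complex and r :: int
  assumes "norm q < 1" "q \<noteq> 0"
  shows "((\<lambda>n. qpoch (- q) (q ^ 2) (n + 1) * q ^ n ^ 2 * (rpoch (q ^ 2) (int n - r) * rpoch (q ^ 2) (int n + (r + 1))))
    has_sum (q powi r ^ 2 + q powi (r + 1) ^ 2) * qprod_ratio q) UNIV"
proof -
  have *: "q ^ s ^ 2 * (1 + q ^ (2 * s + 1)) = q powi (int s) ^ 2 + q powi (int s + 1) ^ 2" for s
  proof -
    have "(int s + 1) ^ 2 = int (s ^ 2 + (2 * s + 1))" "(int s) ^ 2 = int (s ^ 2)"
      by (simp_all add: power2_eq_square algebra_simps)
    then show ?thesis
      by (simp only: power_int_of_nat power_add ring_distribs mult_1_right)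
  qed
  show ?thesis
  proof (cases "r \<ge> 0")
    case True
    define s where "s = nat r"
    have r: "r = int s" using True by (simp add: s_def)
    show ?thesis
      using odd_kernel_nat[OF assms(1), of s] unfolding * r by (simp add: add.assoc)
  next
    case False
    define s where "s = nat (- r - 1)"
    have r: "r = - int s - 1" using False by (simp add: s_def)
    have 1: "q powi r ^ 2 = q powi (int s + 1) ^ 2"
      unfolding r by (simp add: power2_eq_square algebra_simps)
    have 2: "q powi (r + 1) ^ 2 = q powi (int s) ^ 2"
      unfolding r by simp
    have 3: "int n - r = int n + int s + 1" "int n + (r + 1) = int n - int s" for n
      unfolding r by simp_all
    show ?thesis
      unfolding 1 2 3 using odd_kernel_nat[OF assms(1), of s] unfolding * by (simp add: add_ac mult_ac)
  qed
qed

lemma norm_mult_rpoch_le: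
  assumes "norm p < 1"
  obtains K where "K > 0" "\<And>x i j. norm (x * (rpoch p i * rpoch p j)) \<le> norm x * K"
proof -
  obtain K where K: "K > 0" "\<And>k. norm (rpoch p k) \<le> K"
    using rpoch_bounded[OF assms] by blast
  then have "norm (rpoch p i * rpoch p j) \<le> K * K" for i j
    by (auto simp: norm_mult intro!: mult_mono)
  then have "norm (x * (rpoch p i * rpoch p j)) \<le> norm x * (K * K)" for x i j
    unfolding norm_mult[of x] by (intro mult_left_mono) auto
  then show ?thesis
    using that[of "K * K"] K(1) by simp
qed

lemma summable_mult_rpoch:
  fixes c :: "'a \<Rightarrow> complex" and i j :: "'a \<Rightarrow> int"
  assumes "norm p < 1" "(\<lambda>r. norm (c r)) summable_on S"
  shows "(\<lambda>r. c r * (rpoch p (i r) * rpoch p (j r))) summable_on S"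
proof -
  obtain K where "K > 0" and K: "\<And>x i j. norm (x * (rpoch p i * rpoch p j)) \<le> norm x * K"
    using norm_mult_rpoch_le[OF assms(1)] by blast
  have "(\<lambda>r. norm (c r * (rpoch p (i r) * rpoch p (j r)))) summable_on S"
    by (rule summable_on_comparison_test[OF summable_on_cmult_left[OF assms(2)] K]) simp
  then show ?thesis
    by (rule abs_summable_summable)
qed

section \<open>Interchange of summations\<close>

text \<open>A form of Bailey's transform. Since \<open>rpoch\<close> is bounded, absolute
  summability of \<open>W\<close> and of \<open>c\<close> makes the double family summable, and it
  may be summed in either order.\<close>

lemma bailey_exchange:
  fixes W :: "nat \<Rightarrow> complex" and c k :: "int \<Rightarrow> complex" and g h :: "int \<Rightarrow> int"
  assumes p: "norm p < 1"
    and W: "(\<lambda>n. norm (W n)) summable_on UNIV" and c: "(\<lambda>r. norm (c r)) summable_on UNIV"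
    and k: "\<And>r. ((\<lambda>n. W n * (rpoch p (int n - g r) * rpoch p (int n + h r))) has_sum k r) UNIV"
  shows "((\<lambda>n. W n * (\<Sum>\<^sub>\<infinity>r. c r * (rpoch p (int n - g r) * rpoch p (int n + h r))))
    has_sum (\<Sum>\<^sub>\<infinity>r. c r * k r)) UNIV"
proof -
  define f where "f = (\<lambda>(n, r). W n * (c r * (rpoch p (int n - g r) * rpoch p (int n + h r))))"
  define A where "A n = (\<Sum>\<^sub>\<infinity>r. c r * (rpoch p (int n - g r) * rpoch p (int n + h r)))" for n
  have A: "((\<lambda>r. c r * (rpoch p (int n - g r) * rpoch p (int n + h r))) has_sum A n) UNIV" for n
    unfolding A_def by (rule has_sum_infsum[OF summable_mult_rpoch[OF p c]])
  have "(\<lambda>x. W (fst x) * c (snd x) * (rpoch p (int (fst x) - g (snd x)) * rpoch p (int (fst x) + h (snd x))))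
      summable_on UNIV \<times> UNIV"
  proof (rule summable_mult_rpoch[OF p])
    have "(W has_sum infsum W UNIV) UNIV" "(c has_sum infsum c UNIV) UNIV"
      by (rule has_sum_infsum[OF abs_summable_summable], fact W c)+
    from has_sum_product_complex[OF this]
    show "(\<lambda>x. norm (W (fst x) * c (snd x))) summable_on UNIV \<times> UNIV"
      unfolding summable_on_iff_abs_summable_on_complex [symmetric] case_prod_unfold
      by (rule has_sum_imp_summable)
  qed
  then have f: "(f has_sum infsum f (UNIV \<times> UNIV)) (UNIV \<times> UNIV)"
    unfolding f_def case_prod_unfold mult.assoc by (rule has_sum_infsum)
  have "((\<lambda>n. W n * A n) has_sum infsum f (UNIV \<times> UNIV)) UNIV"
  proof (rule has_sum_SigmaD[OF f])
    show "((\<lambda>r. f (n, r)) has_sum W n * A n) UNIV" for n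
      unfolding f_def prod.case by (rule has_sum_cmult_right[OF A])
  qed
  moreover have "((\<lambda>r. c r * k r) has_sum infsum f (UNIV \<times> UNIV)) UNIV"
  proof (rule has_sum_SigmaD)
    show "((\<lambda>(r, n). f (n, r)) has_sum infsum f (UNIV \<times> UNIV)) (UNIV \<times> UNIV)"
      using f by (rule has_sum_swap[THEN iffD1])
    show "((\<lambda>n. case (r, n) of (r, n) \<Rightarrow> f (n, r)) has_sum c r * k r) UNIV" for r
      using has_sum_cmult_right[OF k[of r], of "c r"] by (simp add: f_def mult_ac)
  qed
  ultimately show ?thesis
    by (simp add: A_def infsumI)
qed

text \<open>The finite identities evaluate only the combined sum \<open>\<beta> n\<close>. Both
  halves converge absolutely, so each is exchanged separately and the results are
  subtracted.\<close>

lemma bailey_exchange_diff: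
  fixes W \<beta> :: "nat \<Rightarrow> complex" and c d k l :: "int \<Rightarrow> complex" and g h g' h' :: "int \<Rightarrow> int"
  assumes p: "norm p < 1"
    and W: "(\<lambda>n. norm (W n)) summable_on UNIV"
    and c: "(\<lambda>r. norm (c r)) summable_on UNIV" and d: "(\<lambda>r. norm (d r)) summable_on UNIV"
    and k: "\<And>r. ((\<lambda>n. W n * (rpoch p (int n - g r) * rpoch p (int n + h r))) has_sum k r) UNIV"
    and l: "\<And>r. ((\<lambda>n. W n * (rpoch p (int n - g' r) * rpoch p (int n + h' r))) has_sum l r) UNIV"
    and \<beta>: "\<And>n. ((\<lambda>r. c r * (rpoch p (int n - g r) * rpoch p (int n + h r))
      - d r * (rpoch p (int n - g' r) * rpoch p (int n + h' r))) has_sum \<beta> n) UNIV"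
  shows "((\<lambda>n. W n * \<beta> n) has_sum ((\<Sum>\<^sub>\<infinity>r. c r * k r) - (\<Sum>\<^sub>\<infinity>r. d r * l r))) UNIV"
proof -
  define A B where "A n = (\<Sum>\<^sub>\<infinity>r. c r * (rpoch p (int n - g r) * rpoch p (int n + h r)))"
    and "B n = (\<Sum>\<^sub>\<infinity>r. d r * (rpoch p (int n - g' r) * rpoch p (int n + h' r)))" for n
  have A: "((\<lambda>r. c r * (rpoch p (int n - g r) * rpoch p (int n + h r))) has_sum A n) UNIV"
    and B: "((\<lambda>r. d r * (rpoch p (int n - g' r) * rpoch p (int n + h' r))) has_sum B n) UNIV" for n
    unfolding A_def B_def by (rule has_sum_infsum[OF summable_mult_rpoch[OF p c]], rule has_sum_infsum[OF summable_mult_rpoch[OF p d]])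
  have sums: "((\<lambda>n. W n * A n) has_sum (\<Sum>\<^sub>\<infinity>r. c r * k r)) UNIV"
    "((\<lambda>n. W n * B n) has_sum (\<Sum>\<^sub>\<infinity>r. d r * l r)) UNIV"
    unfolding A_def B_def using bailey_exchange[where g = g and h = h, OF p W c k]
      bailey_exchange[where g = g' and h = h', OF p W d l] by simp_all
  have "\<beta> n = A n - B n" for n
  proof (rule has_sum_unique[OF \<beta>])
    show "((\<lambda>r. c r * (rpoch p (int n - g r) * rpoch p (int n + h r))
      - d r * (rpoch p (int n - g' r) * rpoch p (int n + h' r))) has_sum (A n - B n)) UNIV"
      using has_sum_add[OF A[of n] has_sum_uminusI[OF B[of n]]] by simp
  qed
  then show ?thesis
    using has_sum_add[OF sums(1) has_sum_uminusI[OF sums(2)]] by (simp add: right_diff_distrib)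
qed

section \<open>The two families of series\<close>

lemma gbinom_even_centre:
  "gbinom p (2 * n) (int n - j) = qpoch p p (2 * n) * (rpoch p (int n - j) * rpoch p (int n + j))"
proof -
  have "int (2 * n) - (int n - j) = int n + j" by simp
  then show ?thesis
    unfolding gbinom_def by (simp only: mult_ac)
qed

lemma gbinom_odd_centre:
  "gbinom p (2 * n + 1) (int n - j) = qpoch p p (2 * n + 1) * (rpoch p (int n - j) * rpoch p (int n + (j + 1)))"
proof -
  have "int (2 * n + 1) - (int n - j) = int n + (j + 1)" by simp
  then show ?thesis
    unfolding gbinom_def by (simp only: mult_ac)
qed

text \<open>Division by \<open>qpoch (q ^ 2) (q ^ 2) (2 * n)\<close> turns each binomial into two
  \<open>rpoch\<close> factors centred at \<open>n\<close>; the inner sum then adds the square of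
  the shift to the exponent.\<close>

lemma even_bailey_sum:
  fixes q :: complex and a b :: "int \<Rightarrow> int" and \<beta> :: "nat \<Rightarrow> complex"
  assumes q: "norm q < 1" "q \<noteq> 0"
    and a: "(\<lambda>r. norm (q powi a r)) summable_on UNIV" and b: "(\<lambda>r. norm (q powi b r)) summable_on UNIV"
    and \<beta>: "\<And>n. ((\<lambda>r. q powi a r * gbinom (q ^ 2) (2 * n) (int n - 3 * r)
      - q powi b r * gbinom (q ^ 2) (2 * n) (int n - 3 * r - 1)) has_sum \<beta> n) UNIV"
  shows "((\<lambda>n. qpoch (- q) (q ^ 2) n * q ^ n ^ 2 * (\<beta> n / qpoch (q ^ 2) (q ^ 2) (2 * n)))
    has_sum ((\<Sum>\<^sub>\<infinity>r. q powi (a r + (3 * r) ^ 2)) - (\<Sum>\<^sub>\<infinity>r. q powi (b r + (3 * r + 1) ^ 2))) * qprod_ratio q) UNIV"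
proof -
  have p: "norm (q ^ 2) < 1"
    by (rule norm_sq_less_1[OF q(1)])
  have W: "(\<lambda>n. norm (qpoch (- q) (q ^ 2) n * q ^ n ^ 2)) summable_on UNIV"
    using summable_qpoch_gaussian[OF q(1), of 0] by simp
  have \<beta>': "((\<lambda>r. q powi a r * (rpoch (q ^ 2) (int n - 3 * r) * rpoch (q ^ 2) (int n + 3 * r))
      - q powi b r * (rpoch (q ^ 2) (int n - (3 * r + 1)) * rpoch (q ^ 2) (int n + (3 * r + 1))))
      has_sum \<beta> n / qpoch (q ^ 2) (q ^ 2) (2 * n)) UNIV" for n
  proof -
    have 1: "int n - 3 * r - 1 = int n - (3 * r + 1)" for r
      by simp
    have "((\<lambda>r. (q powi a r * gbinom (q ^ 2) (2 * n) (int n - 3 * r)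
      - q powi b r * gbinom (q ^ 2) (2 * n) (int n - 3 * r - 1)) / qpoch (q ^ 2) (q ^ 2) (2 * n))
      has_sum \<beta> n / qpoch (q ^ 2) (q ^ 2) (2 * n)) UNIV"
      by (rule has_sum_divide_const[OF \<beta>])
    then show ?thesis
      unfolding 1 gbinom_even_centre using qpoch_self_neq_0[OF p, of "2 * n"]
      by (simp add: diff_divide_distrib)
  qed
  have "((\<lambda>n. qpoch (- q) (q ^ 2) n * q ^ n ^ 2 * (\<beta> n / qpoch (q ^ 2) (q ^ 2) (2 * n)))
    has_sum ((\<Sum>\<^sub>\<infinity>r. q powi a r * (q powi (3 * r) ^ 2 * qprod_ratio q))
      - (\<Sum>\<^sub>\<infinity>r. q powi b r * (q powi (3 * r + 1) ^ 2 * qprod_ratio q)))) UNIV"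
    by (rule bailey_exchange_diff[where g = "\<lambda>r. 3 * r" and h = "\<lambda>r. 3 * r" and g' = "\<lambda>r. 3 * r + 1"
        and h' = "\<lambda>r. 3 * r + 1", OF p W a b even_kernel[OF q(1)] even_kernel[OF q(1)] \<beta>'])
  then show ?thesis
    using q(2) by (simp add: power_int_add infsum_cmult_left' left_diff_distrib flip: mult.assoc)
qed

text \<open>Each binomial now contributes two squares, those of the shift and of its successor, so
  four theta series appear in place of two.\<close>

lemma odd_bailey_sum:
  fixes q :: complex and a b :: "int \<Rightarrow> int" and \<beta> :: "nat \<Rightarrow> complex"
  assumes q: "norm q < 1" "q \<noteq> 0"
    and a: "(\<lambda>r. norm (q powi a r)) summable_on UNIV" and b: "(\<lambda>r. norm (q powi b r)) summable_on UNIV"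
    and \<beta>: "\<And>n. ((\<lambda>r. q powi a r * gbinom (q ^ 2) (2 * n + 1) (int n - 3 * r)
      - q powi b r * gbinom (q ^ 2) (2 * n + 1) (int n - 3 * r - 1)) has_sum \<beta> n) UNIV"
  shows "((\<lambda>n. qpoch (- q) (q ^ 2) (n + 1) * q ^ n ^ 2 * (\<beta> n / qpoch (q ^ 2) (q ^ 2) (2 * n + 1)))
    has_sum ((\<Sum>\<^sub>\<infinity>r. q powi (a r + (3 * r) ^ 2) + q powi (a r + (3 * r + 1) ^ 2))
      - (\<Sum>\<^sub>\<infinity>r. q powi (b r + (3 * r + 1) ^ 2) + q powi (b r + (3 * r + 2) ^ 2))) * qprod_ratio q) UNIV"
proof -
  have p: "norm (q ^ 2) < 1"
    by (rule norm_sq_less_1[OF q(1)])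
  have \<beta>': "((\<lambda>r. q powi a r * (rpoch (q ^ 2) (int n - 3 * r) * rpoch (q ^ 2) (int n + (3 * r + 1)))
      - q powi b r * (rpoch (q ^ 2) (int n - (3 * r + 1)) * rpoch (q ^ 2) (int n + (3 * r + 1 + 1))))
      has_sum \<beta> n / qpoch (q ^ 2) (q ^ 2) (2 * n + 1)) UNIV" for n
  proof -
    have 1: "int n - 3 * r - 1 = int n - (3 * r + 1)" for r
      by simp
    have "((\<lambda>r. (q powi a r * gbinom (q ^ 2) (2 * n + 1) (int n - 3 * r)
      - q powi b r * gbinom (q ^ 2) (2 * n + 1) (int n - 3 * r - 1)) / qpoch (q ^ 2) (q ^ 2) (2 * n + 1))
      has_sum \<beta> n / qpoch (q ^ 2) (q ^ 2) (2 * n + 1)) UNIV"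
      by (rule has_sum_divide_const[OF \<beta>])
    then show ?thesis
      unfolding 1 gbinom_odd_centre using qpoch_self_neq_0[OF p, of "2 * n + 1"]
      by (simp add: diff_divide_distrib)
  qed
  have *: "((\<lambda>n. qpoch (- q) (q ^ 2) (n + 1) * q ^ n ^ 2 * (\<beta> n / qpoch (q ^ 2) (q ^ 2) (2 * n + 1)))
    has_sum ((\<Sum>\<^sub>\<infinity>r. q powi a r * ((q powi (3 * r) ^ 2 + q powi (3 * r + 1) ^ 2) * qprod_ratio q))
      - (\<Sum>\<^sub>\<infinity>r. q powi b r * ((q powi (3 * r + 1) ^ 2 + q powi (3 * r + 1 + 1) ^ 2) * qprod_ratio q)))) UNIV"
    by (rule bailey_exchange_diff[where g = "\<lambda>r. 3 * r" and h = "\<lambda>r. 3 * r + 1" and g' = "\<lambda>r. 3 * r + 1"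
        and h' = "\<lambda>r. 3 * r + 1 + 1", OF p summable_qpoch_gaussian[OF q(1)] a b odd_kernel[OF q] odd_kernel[OF q] \<beta>'])
  have 1: "q powi a r * ((q powi (3 * r) ^ 2 + q powi (3 * r + 1) ^ 2) * qprod_ratio q)
      = (q powi (a r + (3 * r) ^ 2) + q powi (a r + (3 * r + 1) ^ 2)) * qprod_ratio q" for r
    using q(2) by (simp add: power_int_add ring_distribs)
  have 2: "q powi b r * ((q powi (3 * r + 1) ^ 2 + q powi (3 * r + 1 + 1) ^ 2) * qprod_ratio q)
      = (q powi (b r + (3 * r + 1) ^ 2) + q powi (b r + (3 * r + 2) ^ 2)) * qprod_ratio q" for r
    using q(2) by (simp add: power_int_add ring_distribs add.commute)
  show ?thesis
    using * unfolding 1 2 by (simp only: infsum_cmult_left' left_diff_distrib)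
qed

section \<open>Theta series as products, and the three initial values\<close>

text \<open>The quintuple product at \<open>t = q ^ 7\<close>, \<open>z = q ^ j\<close>. The values
  3, 1 and 5 of \<open>j\<close> give the three products of the theorem; \<open>j \<le> 7\<close>
  keeps the subtractions exact.\<close>

definition quintuple :: "complex \<Rightarrow> nat \<Rightarrow> complex" where
  "quintuple q j = qpoch_inf_list [q ^ j, q ^ (14 - j), q ^ 14] (q ^ 14)
     * qpoch_inf_list [q ^ (14 - 2 * j), q ^ (14 + 2 * j)] (q ^ 28)"

lemma infsum_reflect:
  fixes f :: "int \<Rightarrow> complex"
  shows "(\<Sum>\<^sub>\<infinity>r. f (c - r)) = (\<Sum>\<^sub>\<infinity>r. f r)"
  by (rule infsum_reindex_bij_betw) (rule bij_betwI[of _ _ _ "\<lambda>r. c - r"], auto)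

lemma quintuple_eq:
  fixes q :: complex and j :: nat
  assumes q: "norm q < 1" "q \<noteq> 0" and j: "j \<le> 7"
  shows "quintuple q j = (\<Sum>\<^sub>\<infinity>r. q powi (21 * r ^ 2 + (3 * int j - 7) * r))
    - (\<Sum>\<^sub>\<infinity>r. q powi (21 * r ^ 2 + (3 * int j + 7) * r + int j))"
proof -
  have t: "norm (q ^ 7) < 1" "q ^ 7 \<noteq> 0" "q ^ j \<noteq> 0"
    using q by (auto simp: norm_power power_less_one_iff)
  have 1: "(q ^ 7) powi (3 * r ^ 2 - r) * (q ^ j) powi (3 * r) = q powi (21 * r ^ 2 + (3 * int j - 7) * r)" for r
    unfolding power_int_power power_int_add[OF disjI1[OF q(2)], symmetric] by (simp add: algebra_simps)
  have 2: "(q ^ 7) powi (3 * r ^ 2 + r) * (q ^ j) powi (3 * r + 1)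
      = q powi (21 * r ^ 2 + (3 * int j + 7) * r + int j)" for r
    unfolding power_int_power power_int_add[OF disjI1[OF q(2)], symmetric] by (simp add: algebra_simps)
  have 3: "(q ^ 7) ^ 2 = q ^ 14" "(q ^ 14) ^ 2 = q ^ 28"
    by (simp_all flip: power_mult)
  have 4: "q ^ 14 / q ^ j = q ^ (14 - j)"
    using q(2) j by (simp add: power_diff)
  have 5: "q ^ 14 * (q ^ j) ^ 2 = q ^ (14 + 2 * j)"
    by (simp add: power_add mult.commute flip: power_mult)
  have 6: "q ^ 14 / (q ^ j) ^ 2 = q ^ (14 - 2 * j)"
    using q(2) j by (simp add: power_diff mult.commute flip: power_mult)
  show ?thesis
    using quintuple_product(3)[OF t] unfolding 1 2 3 4 5 6
    by (simp add: quintuple_def qpoch_inf_list_def mult_ac)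
qed

definition even_term :: "complex \<Rightarrow> nat \<Rightarrow> nat \<Rightarrow> complex" where
  "even_term q m n = qpoch (- q) (q ^ 2) n * q ^ (n ^ 2 + 2 * m * n) / qpoch (q ^ 2) (q ^ 2) (2 * n)"

definition odd_term :: "complex \<Rightarrow> nat \<Rightarrow> nat \<Rightarrow> complex" where
  "odd_term q m n = qpoch (- q) (q ^ 2) (n + 1) * q ^ (n ^ 2 + 2 * m * n) / qpoch (q ^ 2) (q ^ 2) (2 * n + 1)"

context
  fixes q :: complex
  assumes q: "norm q < 1" "q \<noteq> 0"
begin

lemma sq: "norm (q ^ 2) < 1" "q ^ 2 \<noteq> 0"
  using norm_sq_less_1[OF q(1)] q(2) by auto

text \<open>From \<open>strip_even_has_sum\<close>: the total exponents
  \<open>21 * r ^ 2 + 2 * r\<close> and \<open>21 * r ^ 2 + 16 * r + 3\<close> are those of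
  \<open>quintuple_eq\<close> at \<open>j = 3\<close>.\<close>

lemma even_term_0_has_sum: "(even_term q 0 has_sum quintuple q 3 * qprod_ratio q) UNIV"
proof -
  have 1: "(q ^ 2) powi (6 * r ^ 2 + r) = q powi (12 * r ^ 2 + 2 * r + 0)"
    and 2: "(q ^ 2) powi (6 * r ^ 2 + 5 * r + 1) = q powi (12 * r ^ 2 + 10 * r + 2)" for r
    unfolding power_int_power by (simp_all add: algebra_simps)
  have "((\<lambda>n. qpoch (- q) (q ^ 2) n * q ^ n ^ 2 * (1 / qpoch (q ^ 2) (q ^ 2) (2 * n)))
    has_sum ((\<Sum>\<^sub>\<infinity>r. q powi (12 * r ^ 2 + 2 * r + 0 + (3 * r) ^ 2))
      - (\<Sum>\<^sub>\<infinity>r. q powi (12 * r ^ 2 + 10 * r + 2 + (3 * r + 1) ^ 2))) * qprod_ratio q) UNIV"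
    using strip_even_has_sum[OF sq] unfolding strip_even_def 1 2
    by (intro even_bailey_sum[where \<beta> = "\<lambda>_. 1"] q summable_powi_quadratic) (simp_all add: strip_even_def [abs_def] 1 2)
  moreover have "quintuple q 3 = (\<Sum>\<^sub>\<infinity>r. q powi (12 * r ^ 2 + 2 * r + 0 + (3 * r) ^ 2))
      - (\<Sum>\<^sub>\<infinity>r. q powi (12 * r ^ 2 + 10 * r + 2 + (3 * r + 1) ^ 2))"
    by (subst quintuple_eq[OF q]) (simp_all add: power2_eq_square algebra_simps)
  ultimately show ?thesis
    by (simp add: even_term_def [abs_def])
qed

lemma even_term_1_has_sum: "(even_term q 1 has_sum quintuple q 1 * qprod_ratio q) UNIV"
proof -
  have 1: "(q ^ 2) powi (6 * r ^ 2 + 2 * r) = q powi (12 * r ^ 2 + 4 * r + 0)" for r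
    unfolding power_int_power by (simp_all add: algebra_simps)
  have "((\<lambda>n. qpoch (- q) (q ^ 2) n * q ^ n ^ 2 * ((q ^ 2) ^ n / qpoch (q ^ 2) (q ^ 2) (2 * n)))
    has_sum ((\<Sum>\<^sub>\<infinity>r. q powi (12 * r ^ 2 + 4 * r + 0 + (3 * r) ^ 2))
      - (\<Sum>\<^sub>\<infinity>r. q powi (12 * r ^ 2 + 4 * r + 0 + (3 * r + 1) ^ 2))) * qprod_ratio q) UNIV"
    using strip_even_shifted_has_sum[OF sq] unfolding 1
    by (intro even_bailey_sum q summable_powi_quadratic) simp_all
  \<comment> \<open>The exponents are \<open>21 * r ^ 2 + 4 * r\<close> and
    \<open>21 * r ^ 2 + 10 * r + 1\<close>; the first series matches \<open>j = 1\<close> only after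
    \<open>r\<close> is replaced by \<open>- r\<close>.\<close>
  moreover have "quintuple q 1 = (\<Sum>\<^sub>\<infinity>r. q powi (12 * r ^ 2 + 4 * r + 0 + (3 * r) ^ 2))
      - (\<Sum>\<^sub>\<infinity>r. q powi (12 * r ^ 2 + 4 * r + 0 + (3 * r + 1) ^ 2))"
    by (subst quintuple_eq[OF q], simp, subst infsum_reflect[of _ 0, symmetric])
      (simp_all add: power2_eq_square algebra_simps)
  moreover have "even_term q 1 = (\<lambda>n. qpoch (- q) (q ^ 2) n * q ^ n ^ 2 * ((q ^ 2) ^ n / qpoch (q ^ 2) (q ^ 2) (2 * n)))"
    by (simp add: even_term_def [abs_def] power_add power_mult mult.assoc)
  ultimately show ?thesis
    by (simp only:)
qed

lemma odd_term_1_has_sum: "(odd_term q 1 has_sum quintuple q 5 * qprod_ratio q) UNIV"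
proof -
  have 1: "(q ^ 2) powi (6 * r ^ 2 + 4 * r) = q powi (12 * r ^ 2 + 8 * r + 0)" for r
    unfolding power_int_power by (simp_all add: algebra_simps)
  have *: "((\<lambda>n. qpoch (- q) (q ^ 2) (n + 1) * q ^ n ^ 2 * ((q ^ 2) ^ n / qpoch (q ^ 2) (q ^ 2) (2 * n + 1)))
    has_sum ((\<Sum>\<^sub>\<infinity>r. q powi (12 * r ^ 2 + 8 * r + 0 + (3 * r) ^ 2) + q powi (12 * r ^ 2 + 8 * r + 0 + (3 * r + 1) ^ 2))
      - (\<Sum>\<^sub>\<infinity>r. q powi (12 * r ^ 2 + 8 * r + 0 + (3 * r + 1) ^ 2) + q powi (12 * r ^ 2 + 8 * r + 0 + (3 * r + 2) ^ 2))) * qprod_ratio q) UNIV"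
    using strip_odd_shifted_has_sum[OF sq] unfolding 1
    by (intro odd_bailey_sum q summable_powi_quadratic) simp_all
  have e: "12 * r ^ 2 + 8 * r + 0 + (3 * r) ^ 2 = 21 * r ^ 2 + 8 * r + 0"
    "12 * r ^ 2 + 8 * r + 0 + (3 * r + 1) ^ 2 = 21 * r ^ 2 + 14 * r + 1"
    "12 * r ^ 2 + 8 * r + 0 + (3 * r + 2) ^ 2 = 21 * r ^ 2 + 20 * r + 4" for r :: int
    by (simp_all add: power2_eq_square algebra_simps)
  \<comment> \<open>Of the four series, the two with exponent \<open>21 * r ^ 2 + 14 * r + 1\<close>
    cancel because both finite coefficients carry the same power of \<open>q\<close>.\<close>
  have cancel: "x + y - (y + z) = x - z" for x y z :: complex
    by simp
  have s: "(\<lambda>r. q powi (21 * r ^ 2 + b * r + c)) summable_on UNIV" for b c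
    by (intro summable_powi_quadratic q) simp
  have "quintuple q 5 = (\<Sum>\<^sub>\<infinity>r. q powi (21 * r ^ 2 + 8 * r + 0)) - (\<Sum>\<^sub>\<infinity>r. q powi (21 * r ^ 2 + 22 * r + 5))"
    by (subst quintuple_eq[OF q]) simp_all
  also have "(\<Sum>\<^sub>\<infinity>r. q powi (21 * r ^ 2 + 22 * r + 5)) = (\<Sum>\<^sub>\<infinity>r. q powi (21 * r ^ 2 + 20 * r + 4))"
    by (subst infsum_reflect[of _ "- 1", symmetric]) (simp add: power2_eq_square algebra_simps)
  finally have "quintuple q 5 = (\<Sum>\<^sub>\<infinity>r. q powi (21 * r ^ 2 + 8 * r + 0)) - (\<Sum>\<^sub>\<infinity>r. q powi (21 * r ^ 2 + 20 * r + 4))" .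
  moreover have "odd_term q 1 = (\<lambda>n. qpoch (- q) (q ^ 2) (n + 1) * q ^ n ^ 2 * ((q ^ 2) ^ n / qpoch (q ^ 2) (q ^ 2) (2 * n + 1)))"
    by (simp add: odd_term_def [abs_def] power_add power_mult mult.assoc)
  ultimately show ?thesis
    using * unfolding e infsum_add[OF s s] by (simp only: cancel)
qed

section \<open>Termwise relations and the third-order recursions\<close>

text \<open>Passing from \<open>m\<close> to \<open>Suc m\<close> with the prefactor
  \<open>q\<close> multiplies a term by \<open>x = q ^ (2 * n + 1)\<close>. The factor
  \<open>1 - x\<close> then cancels against \<open>(1 + x) / (1 - x * x)\<close>, the ratio of the
  odd term to the even one.\<close>

lemma odd_term_eq: "odd_term q m n = even_term q m n + q * odd_term q (Suc m) n"
proof -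
  define x where "x = q * q ^ (2 * n)"
  have x: "q * (q ^ 2) ^ n = x" "q * q ^ (2 * n) = x" "q ^ 2 * (q ^ 2) ^ (2 * n) = x * x"
    unfolding x_def power_mult [symmetric] by simp_all (simp add: power2_eq_square mult_ac flip: power_add)
  have "1 - x * x \<noteq> 0"
    using qpoch_self_neq_0[OF sq(1), of "Suc (2 * n)"] by (auto simp: qpoch_Suc x)
  have 1: "qpoch (- q) (q ^ 2) (n + 1) = qpoch (- q) (q ^ 2) n * (1 + x)"
    by (simp add: qpoch_Suc x)
  have 2: "qpoch (q ^ 2) (q ^ 2) (2 * n + 1) = qpoch (q ^ 2) (q ^ 2) (2 * n) * (1 - x * x)"
    by (simp add: qpoch_Suc x)
  have 3: "q * q ^ (n ^ 2 + 2 * Suc m * n) = x * q ^ (n ^ 2 + 2 * m * n)"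
    unfolding x_def by (simp add: power_add algebra_simps flip: power_mult)
  have "q * odd_term q (Suc m) n = qpoch (- q) (q ^ 2) (n + 1) * (q * q ^ (n ^ 2 + 2 * Suc m * n))
      / qpoch (q ^ 2) (q ^ 2) (2 * n + 1)"
    by (simp add: odd_term_def)
  then have 4: "q * odd_term q (Suc m) n = qpoch (- q) (q ^ 2) n * (1 + x) * (x * q ^ (n ^ 2 + 2 * m * n))
      / (qpoch (q ^ 2) (q ^ 2) (2 * n) * (1 - x * x))"
    unfolding 1 2 3 .
  show ?thesis
    unfolding 4 unfolding odd_term_def even_term_def 1 2
    using \<open>1 - x * x \<noteq> 0\<close> qpoch_self_neq_0[OF sq(1), of "2 * n"]
    by (simp add: divide_simps) (simp add: algebra_simps)
qed

lemma even_term_0 [simp]: "even_term q m 0 = 1"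
  by (simp add: even_term_def)

text \<open>The difference produces \<open>1 - q ^ (4 * n + 4)\<close>, the last factor of the
  denominator. The index is \<open>Suc n\<close> because the terms at index 0 equal 1 for every
  \<open>m\<close> and drop out, which aligns the rest with the odd terms from index 0.\<close>

lemma even_term_diff: "even_term q m (Suc n) - even_term q (m + 2) (Suc n) = q ^ (2 * m + 1) * odd_term q (Suc m) n"
proof -
  define y where "y = q ^ (4 * n + 4)"
  have y: "q ^ 2 * (q ^ 2) ^ (2 * n + 1) = y"
  proof -
    have "2 + 2 * (2 * n + 1) = 4 * n + 4"
      by simp
    then show ?thesis
      unfolding y_def power_mult [symmetric] power_add [symmetric] by (simp only:)
  qed
  have "1 - y \<noteq> 0"
    using qpoch_self_neq_0[OF sq(1), of "Suc (2 * n + 1)"] y by (auto simp: qpoch_Suc)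
  have 1: "qpoch (q ^ 2) (q ^ 2) (2 * Suc n) = qpoch (q ^ 2) (q ^ 2) (2 * n + 1) * (1 - y)"
    using qpoch_Suc[of "q ^ 2" "q ^ 2" "2 * n + 1"] y by simp
  have e: "Suc n ^ 2 + 2 * (m + 2) * Suc n = (Suc n ^ 2 + 2 * m * Suc n) + (4 * n + 4)"
    "Suc n ^ 2 + 2 * m * Suc n = (2 * m + 1) + (n ^ 2 + 2 * Suc m * n)"
    by (simp_all add: power2_eq_square algebra_simps)
  have "even_term q m (Suc n) - even_term q (m + 2) (Suc n)
      = qpoch (- q) (q ^ 2) (Suc n) * q ^ (Suc n ^ 2 + 2 * m * Suc n) * (1 - y) / (qpoch (q ^ 2) (q ^ 2) (2 * n + 1) * (1 - y))"
    unfolding even_term_def 1 e(1) power_add[of q _ "4 * n + 4"] y_def [symmetric]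
    by (simp add: algebra_simps diff_divide_distrib)
  also have "\<dots> = q ^ (2 * m + 1) * odd_term q (Suc m) n"
    using \<open>1 - y \<noteq> 0\<close> unfolding e(2) power_add[of q "2 * m + 1"] odd_term_def by simp
  finally show ?thesis .
qed

text \<open>Reduces summability for all \<open>m\<close> to \<open>m = 0\<close>. The even case is
  already evaluated there, and the odd one follows from \<open>odd_term_eq\<close>.\<close>

lemma term_le:
  "norm (even_term q m n) \<le> norm (even_term q 0 n)" "norm (odd_term q m n) \<le> norm (odd_term q 0 n)"
proof -
  have "norm q ^ (n ^ 2 + 2 * m * n) \<le> norm q ^ n ^ 2"
    using q(1) by (intro power_decreasing) auto
  then show "norm (even_term q m n) \<le> norm (even_term q 0 n)" "norm (odd_term q m n) \<le> norm (odd_term q 0 n)"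
    by (auto simp: even_term_def odd_term_def norm_mult norm_divide norm_power intro!: divide_right_mono mult_left_mono)
qed

definition even_series :: "nat \<Rightarrow> complex" where "even_series m = (\<Sum>\<^sub>\<infinity>n. even_term q m n)"
definition odd_series :: "nat \<Rightarrow> complex" where "odd_series m = (\<Sum>\<^sub>\<infinity>n. odd_term q m n)"

lemma even_series: "(even_term q m has_sum even_series m) UNIV"
proof -
  have "(\<lambda>n. norm (even_term q 0 n)) summable_on UNIV"
    using even_term_0_has_sum unfolding summable_on_iff_abs_summable_on_complex [symmetric]
    by (rule has_sum_imp_summable)
  then have "(\<lambda>n. norm (even_term q m n)) summable_on UNIV"
    by (rule summable_on_comparison_test) (simp_all add: term_le)
  then show ?thesis
    unfolding even_series_def by (rule has_sum_infsum[OF abs_summable_summable])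
qed

lemma odd_series: "(odd_term q m has_sum odd_series m) UNIV"
proof -
  have "((\<lambda>n. even_term q 0 n + q * odd_term q 1 n) has_sum
      (quintuple q 3 * qprod_ratio q + q * (quintuple q 5 * qprod_ratio q))) UNIV"
    by (intro has_sum_add has_sum_cmult_right even_term_0_has_sum odd_term_1_has_sum)
  then have "(\<lambda>n. norm (odd_term q 0 n)) summable_on UNIV"
    unfolding summable_on_iff_abs_summable_on_complex [symmetric]
    by (subst odd_term_eq) (simp add: has_sum_imp_summable)
  then have "(\<lambda>n. norm (odd_term q m n)) summable_on UNIV"
    by (rule summable_on_comparison_test) (simp_all add: term_le)
  then show ?thesis
    unfolding odd_series_def by (rule has_sum_infsum[OF abs_summable_summable])
qed

lemma odd_series_eq: "odd_series m = even_series m + q * odd_series (Suc m)"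
proof (rule has_sum_unique[OF odd_series])
  show "(odd_term q m has_sum even_series m + q * odd_series (Suc m)) UNIV"
    using has_sum_add[OF even_series[of m] has_sum_cmult_right[OF odd_series[of "Suc m"], of q]]
    by (simp only: odd_term_eq [symmetric])
qed

lemma even_series_diff: "even_series m - even_series (m + 2) = q ^ (2 * m + 1) * odd_series (Suc m)"
proof (rule has_sum_unique)
  show "((\<lambda>n. even_term q m n - even_term q (m + 2) n) has_sum even_series m - even_series (m + 2)) UNIV"
    using has_sum_add[OF even_series[of m] has_sum_uminusI[OF even_series[of "m + 2"]]] by simp
  have "((\<lambda>n. q ^ (2 * m + 1) * odd_term q (Suc m) n) has_sum q ^ (2 * m + 1) * odd_series (Suc m)) UNIV"
    by (rule has_sum_cmult_right[OF odd_series])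
  then show "((\<lambda>n. even_term q m n - even_term q (m + 2) n) has_sum q ^ (2 * m + 1) * odd_series (Suc m)) UNIV"
    unfolding even_term_diff [symmetric] by (subst has_sum_nat_shift[of 1]) auto
qed

lemma series_values:
  "even_series 0 = quintuple q 3 * qprod_ratio q"
  "even_series 1 = quintuple q 1 * qprod_ratio q"
  "odd_series 1 = quintuple q 5 * qprod_ratio q"
  using has_sum_unique[OF even_series even_term_0_has_sum] has_sum_unique[OF even_series even_term_1_has_sum]
    has_sum_unique[OF odd_series odd_term_1_has_sum] by auto

text \<open>Two instances of \<open>even_series_diff\<close> and one of \<open>odd_series_eq\<close>
  are linear in the odd series at \<open>k + 1\<close> and \<open>k + 2\<close>; eliminating these
  leaves only even series.\<close>

lemma even_series_rec: "even_sum_rec q even_series"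
  unfolding even_sum_rec_def
proof (intro allI impI)
  fix m :: nat assume "m \<ge> 3"
  then obtain k where m: "m = k + 3"
    by (metis le_add_diff_inverse2)
  define s where "s = q ^ (2 * k + 1)"
  have s: "q ^ (2 * (k + 3) - 4) = q * s" "q ^ (2 * Suc k + 1) = q ^ 2 * s" "s \<noteq> 0"
    using q(2) by (simp_all add: s_def power_add power2_eq_square)
  have 1: "even_series k - even_series (k + 2) = s * odd_series (k + 1)"
    using even_series_diff[of k] by (simp add: s_def)
  have 2: "even_series (k + 1) - even_series (k + 3) = q ^ 2 * s * odd_series (k + 2)"
    using even_series_diff[of "Suc k"] unfolding s(2) by (simp add: numeral_3_eq_3)
  have 3: "odd_series (k + 1) = even_series (k + 1) + q * odd_series (k + 2)"
    using odd_series_eq[of "Suc k"] by simp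
  have "even_series (k + 3) = q * even_series (k + 2) + (1 + q * s) * even_series (k + 1) - q * even_series k"
    using 1 2 3 by algebra
  then show "even_series m = q * even_series (m - 1) + (1 + q ^ (2 * m - 4)) * even_series (m - 2) - q * even_series (m - 3)"
    unfolding m s(1) by (simp add: eval_nat_numeral)
qed

text \<open>Here the even series at \<open>k\<close> and \<open>k + 2\<close> are eliminated. The
  relation obtained has leading coefficient \<open>q\<close>, and multiplication by
  \<open>q ^ (k + 2)\<close> absorbs it into the normalization \<open>q ^ m\<close>.\<close>

lemma odd_series_rec: "odd_sum_rec q (\<lambda>m. q ^ m * odd_series m)"
  unfolding odd_sum_rec_def
proof (intro allI impI)
  fix m :: nat assume "m \<ge> 3"
  then obtain k where m: "m = k + 3"
    by (metis le_add_diff_inverse2)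
  define s where "s = q ^ (2 * k + 1)"
  have s: "q ^ (2 * (k + 3) - 4) = q * s"
    by (simp add: s_def)
  have 1: "even_series k - even_series (k + 2) = s * odd_series (k + 1)"
    using even_series_diff[of k] by (simp add: s_def)
  have 2: "odd_series k = even_series k + q * odd_series (k + 1)"
    using odd_series_eq[of k] by simp
  have 3: "odd_series (k + 2) = even_series (k + 2) + q * odd_series (k + 3)"
    using odd_series_eq[of "k + 2"] by (simp add: numeral_3_eq_3)
  have "q * odd_series (k + 3) = odd_series (k + 2) + (q + s) * odd_series (k + 1) - odd_series k"
    using 1 2 3 by algebra
  then have "q ^ (k + 2) * (q * odd_series (k + 3)) = q ^ (k + 2) * (odd_series (k + 2) + (q + s) * odd_series (k + 1) - odd_series k)"
    by simp
  then have "q ^ (k + 3) * odd_series (k + 3) = q ^ (k + 2) * odd_series (k + 2)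
      + (q ^ 2 + q * s) * (q ^ (k + 1) * odd_series (k + 1)) - q ^ 2 * (q ^ k * odd_series k)"
    by (simp add: power_add power2_eq_square power3_eq_cube algebra_simps)
  then show "q ^ m * odd_series m = q ^ (m - 1) * odd_series (m - 1)
      + (q ^ 2 + q ^ (2 * m - 4)) * (q ^ (m - 2) * odd_series (m - 2)) - q ^ 2 * (q ^ (m - 3) * odd_series (m - 3))"
    unfolding m s by (simp add: eval_nat_numeral)
qed

end

section \<open>Uniqueness and linearity for the recursions, and the final comparison\<close>

lemma third_order_recurrence_unique:
  fixes X Y :: "nat \<Rightarrow> 'a"
  assumes "\<And>m. m \<ge> 3 \<Longrightarrow> X m = f m (X (m - 1)) (X (m - 2)) (X (m - 3))"
    and "\<And>m. m \<ge> 3 \<Longrightarrow> Y m = f m (Y (m - 1)) (Y (m - 2)) (Y (m - 3))"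
    and "X 0 = Y 0" "X 1 = Y 1" "X 2 = Y 2"
  shows "X m = Y m"
proof (induction m rule: less_induct)
  case (less m)
  show ?case
  proof (cases "m \<ge> 3")
    case True
    then show ?thesis
      using less assms(1)[OF True] assms(2)[OF True] by simp
  next
    case False
    then have "m = 0 \<or> m = 1 \<or> m = 2" by auto
    then show ?thesis
      using assms(3-5) by auto
  qed
qed

lemma even_sum_rec_unique:
  assumes "even_sum_rec q X" "even_sum_rec q Y" "X 0 = Y 0" "X 1 = Y 1" "X 2 = Y 2"
  shows "X m = Y m"
  by (rule third_order_recurrence_unique[of X "\<lambda>m x y z. q * x + (1 + q ^ (2 * m - 4)) * y - q * z" Y, OF _ _ assms(3-5)])
    (use assms(1,2) in \<open>unfold even_sum_rec_def, blast\<close>)+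

lemma odd_sum_rec_unique:
  assumes "odd_sum_rec q X" "odd_sum_rec q Y" "X 0 = Y 0" "X 1 = Y 1" "X 2 = Y 2"
  shows "X m = Y m"
  by (rule third_order_recurrence_unique[of X "\<lambda>m x y z. x + (q ^ 2 + q ^ (2 * m - 4)) * y - q ^ 2 * z" Y, OF _ _ assms(3-5)])
    (use assms(1,2) in \<open>unfold odd_sum_rec_def, blast\<close>)+

lemma even_sum_rec_combine:
  assumes "even_sum_rec q X" "even_sum_rec q Y" "even_sum_rec q Z"
  shows "even_sum_rec q (\<lambda>m. a * X m + b * Y m + c * Z m)"
  unfolding even_sum_rec_def
proof (intro allI impI)
  fix m :: nat assume "m \<ge> 3"
  then have eqs: "X m = q * X (m - 1) + (1 + q ^ (2 * m - 4)) * X (m - 2) - q * X (m - 3)"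
    "Y m = q * Y (m - 1) + (1 + q ^ (2 * m - 4)) * Y (m - 2) - q * Y (m - 3)"
    "Z m = q * Z (m - 1) + (1 + q ^ (2 * m - 4)) * Z (m - 2) - q * Z (m - 3)"
    using assms unfolding even_sum_rec_def by blast+
  show "a * X m + b * Y m + c * Z m = q * (a * X (m - 1) + b * Y (m - 1) + c * Z (m - 1)) + (1 + q ^ (2 * m - 4)) * (a * X (m - 2) + b * Y (m - 2) + c * Z (m - 2)) - q * (a * X (m - 3) + b * Y (m - 3) + c * Z (m - 3))"
    unfolding eqs by (simp add: algebra_simps)
qed

lemma odd_sum_rec_combine:
  assumes "odd_sum_rec q X" "odd_sum_rec q Y" "odd_sum_rec q Z"
  shows "odd_sum_rec q (\<lambda>m. a * X m + b * Y m + c * Z m)"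
  unfolding odd_sum_rec_def
proof (intro allI impI)
  fix m :: nat assume "m \<ge> 3"
  then have eqs: "X m = X (m - 1) + (q ^ 2 + q ^ (2 * m - 4)) * X (m - 2) - q ^ 2 * X (m - 3)"
    "Y m = Y (m - 1) + (q ^ 2 + q ^ (2 * m - 4)) * Y (m - 2) - q ^ 2 * Y (m - 3)"
    "Z m = Z (m - 1) + (q ^ 2 + q ^ (2 * m - 4)) * Z (m - 2) - q ^ 2 * Z (m - 3)"
    using assms unfolding odd_sum_rec_def by blast+
  show "a * X m + b * Y m + c * Z m = (a * X (m - 1) + b * Y (m - 1) + c * Z (m - 1)) + (q ^ 2 + q ^ (2 * m - 4)) * (a * X (m - 2) + b * Y (m - 2) + c * Z (m - 2)) - q ^ 2 * (a * X (m - 3) + b * Y (m - 3) + c * Z (m - 3))"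
    unfolding eqs by (simp add: algebra_simps)
qed

theorem theorem3p4:
  fixes q :: complex
  assumes "0 < norm q" and "norm q < 1"
  shows
   "(\<forall>A B C :: nat \<Rightarrow> complex.
       odd_sum_rec q A \<and> A 0 = 1 \<and> A 1 = 0 \<and> A 2 = 0 \<and>
       odd_sum_rec q B \<and> B 0 = 0 \<and> B 1 = 0 \<and> B 2 = - q \<and>
       odd_sum_rec q C \<and> C 0 = q \<and> C 1 = q \<and> C 2 = q \<longrightarrow>
       (\<forall>m::nat.
          (\<lambda>n. qpoch (- q) (q ^ 2) (n + 1) * q ^ (n ^ 2 + 2 * m * n)
                 / qpoch (q ^ 2) (q ^ 2) (2 * n + 1))
          sums
          (q powi (- int m) * qpoch_inf_list [q ^ 3, q ^ 11, q ^ 14] (q ^ 14)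
               * qpoch_inf_list [q ^ 8, q ^ 20] (q ^ 28) * qpoch_inf (- q) (q ^ 2)
               / qpoch_inf (q ^ 2) (q ^ 2) * A m
           + q powi (- int m) * qpoch_inf_list [q, q ^ 13, q ^ 14] (q ^ 14)
               * qpoch_inf_list [q ^ 12, q ^ 16] (q ^ 28) * qpoch_inf (- q) (q ^ 2)
               / qpoch_inf (q ^ 2) (q ^ 2) * B m
           + q powi (- int m) * qpoch_inf_list [q ^ 5, q ^ 9, q ^ 14] (q ^ 14)
               * qpoch_inf_list [q ^ 4, q ^ 24] (q ^ 28) * qpoch_inf (- q) (q ^ 2)
               / qpoch_inf (q ^ 2) (q ^ 2) * C m)))
    \<and>
    (\<forall>E F G :: nat \<Rightarrow> complex.
       even_sum_rec q E \<and> E 0 = 1 \<and> E 1 = 0 \<and> E 2 = 1 \<and>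
       even_sum_rec q F \<and> F 0 = 0 \<and> F 1 = 1 \<and> F 2 = 0 \<and>
       even_sum_rec q G \<and> G 0 = 0 \<and> G 1 = 0 \<and> G 2 = - q \<longrightarrow>
       (\<forall>m::nat.
          (\<lambda>n. qpoch (- q) (q ^ 2) n * q ^ (n ^ 2 + 2 * m * n)
                 / qpoch (q ^ 2) (q ^ 2) (2 * n))
          sums
          (qpoch_inf_list [q ^ 3, q ^ 11, q ^ 14] (q ^ 14)
               * qpoch_inf_list [q ^ 8, q ^ 20] (q ^ 28) * qpoch_inf (- q) (q ^ 2)
               / qpoch_inf (q ^ 2) (q ^ 2) * E m
           + qpoch_inf_list [q, q ^ 13, q ^ 14] (q ^ 14)
               * qpoch_inf_list [q ^ 12, q ^ 16] (q ^ 28) * qpoch_inf (- q) (q ^ 2)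
               / qpoch_inf (q ^ 2) (q ^ 2) * F m
           + qpoch_inf_list [q ^ 5, q ^ 9, q ^ 14] (q ^ 14)
               * qpoch_inf_list [q ^ 4, q ^ 24] (q ^ 28) * qpoch_inf (- q) (q ^ 2)
               / qpoch_inf (q ^ 2) (q ^ 2) * G m)))"
proof -
  have q: "norm q < 1" "q \<noteq> 0"
    using assms by auto
  define P Q R where "P = quintuple q 3 * qprod_ratio q" and "Q = quintuple q 1 * qprod_ratio q"
    and "R = quintuple q 5 * qprod_ratio q"
  note vals = series_values[OF q, folded P_def Q_def R_def]
  have P: "w * qpoch_inf_list [q ^ 3, q ^ 11, q ^ 14] (q ^ 14)
      * qpoch_inf_list [q ^ 8, q ^ 20] (q ^ 28) * qpoch_inf (- q) (q ^ 2)
      / qpoch_inf (q ^ 2) (q ^ 2) = w * P" for w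
    by (simp add: P_def quintuple_def qprod_ratio_def)
  have Q: "w * qpoch_inf_list [q, q ^ 13, q ^ 14] (q ^ 14)
      * qpoch_inf_list [q ^ 12, q ^ 16] (q ^ 28) * qpoch_inf (- q) (q ^ 2)
      / qpoch_inf (q ^ 2) (q ^ 2) = w * Q" for w
    by (simp add: Q_def quintuple_def qprod_ratio_def)
  have R: "w * qpoch_inf_list [q ^ 5, q ^ 9, q ^ 14] (q ^ 14)
      * qpoch_inf_list [q ^ 4, q ^ 24] (q ^ 28) * qpoch_inf (- q) (q ^ 2)
      / qpoch_inf (q ^ 2) (q ^ 2) = w * R" for w
    by (simp add: R_def quintuple_def qprod_ratio_def)
  \<comment> \<open>The remaining initial data in terms of \<open>P\<close>, \<open>Q\<close>,
    \<open>R\<close>. The coefficients found here are the prescribed values at index 2 of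
    \<open>E\<close>, \<open>F\<close>, \<open>G\<close>, and likewise below for \<open>A\<close>,
    \<open>B\<close>, \<open>C\<close>.\<close>
  have even2: "even_series q 2 = P - q * R"
    using even_series_diff[OF q, of 0] vals by (simp add: numeral_2_eq_2 algebra_simps)
  have odd0: "odd_series q 0 = P + q * R"
    using odd_series_eq[OF q, of 0] vals by simp
  have "R = Q + q * odd_series q 2"
    using odd_series_eq[OF q, of 1] vals by (simp add: numeral_2_eq_2)
  then have odd2: "q * odd_series q 2 = R - Q"
    by simp
  show ?thesis
  proof (intro conjI allI impI; elim conjE)
    fix A B C :: "nat \<Rightarrow> complex" and m :: nat
    assume rec: "odd_sum_rec q A" "odd_sum_rec q B" "odd_sum_rec q C"
      and init: "A 0 = 1" "A 1 = 0" "A 2 = 0" "B 0 = 0" "B 1 = 0" "B 2 = - q" "C 0 = q" "C 1 = q" "C 2 = q"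
    have "q ^ m * odd_series q m = P * A m + Q * B m + R * C m"
    proof (rule odd_sum_rec_unique[OF odd_series_rec[OF q] odd_sum_rec_combine[OF rec]])
      show "q ^ 2 * odd_series q 2 = P * A 2 + Q * B 2 + R * C 2"
        unfolding power2_eq_square mult.assoc odd2 init by (simp add: algebra_simps)
    qed (simp_all add: init [simplified] odd0 vals [simplified])
    then have "odd_series q m = q powi (- int m) * P * A m + q powi (- int m) * Q * B m + q powi (- int m) * R * C m"
      using q(2) by (simp add: power_int_minus field_simps)
    then show "(\<lambda>n. qpoch (- q) (q ^ 2) (n + 1) * q ^ (n ^ 2 + 2 * m * n) / qpoch (q ^ 2) (q ^ 2) (2 * n + 1))
        sums (q powi (- int m) * qpoch_inf_list [q ^ 3, q ^ 11, q ^ 14] (q ^ 14)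
               * qpoch_inf_list [q ^ 8, q ^ 20] (q ^ 28) * qpoch_inf (- q) (q ^ 2)
               / qpoch_inf (q ^ 2) (q ^ 2) * A m
           + q powi (- int m) * qpoch_inf_list [q, q ^ 13, q ^ 14] (q ^ 14)
               * qpoch_inf_list [q ^ 12, q ^ 16] (q ^ 28) * qpoch_inf (- q) (q ^ 2)
               / qpoch_inf (q ^ 2) (q ^ 2) * B m
           + q powi (- int m) * qpoch_inf_list [q ^ 5, q ^ 9, q ^ 14] (q ^ 14)
               * qpoch_inf_list [q ^ 4, q ^ 24] (q ^ 28) * qpoch_inf (- q) (q ^ 2)
               / qpoch_inf (q ^ 2) (q ^ 2) * C m)"
      using has_sum_imp_sums[OF odd_series[OF q, of m]] unfolding P Q R odd_term_def [abs_def] by simp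
  next
    fix E F G :: "nat \<Rightarrow> complex" and m :: nat
    assume rec: "even_sum_rec q E" "even_sum_rec q F" "even_sum_rec q G"
      and init: "E 0 = 1" "E 1 = 0" "E 2 = 1" "F 0 = 0" "F 1 = 1" "F 2 = 0" "G 0 = 0" "G 1 = 0" "G 2 = - q"
    have "even_series q m = P * E m + Q * F m + R * G m"
      by (rule even_sum_rec_unique[OF even_series_rec[OF q] even_sum_rec_combine[OF rec]])
        (simp_all add: init [simplified] even2 vals [simplified])
    then show "(\<lambda>n. qpoch (- q) (q ^ 2) n * q ^ (n ^ 2 + 2 * m * n) / qpoch (q ^ 2) (q ^ 2) (2 * n))
        sums (qpoch_inf_list [q ^ 3, q ^ 11, q ^ 14] (q ^ 14)
               * qpoch_inf_list [q ^ 8, q ^ 20] (q ^ 28) * qpoch_inf (- q) (q ^ 2)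
               / qpoch_inf (q ^ 2) (q ^ 2) * E m
           + qpoch_inf_list [q, q ^ 13, q ^ 14] (q ^ 14)
               * qpoch_inf_list [q ^ 12, q ^ 16] (q ^ 28) * qpoch_inf (- q) (q ^ 2)
               / qpoch_inf (q ^ 2) (q ^ 2) * F m
           + qpoch_inf_list [q ^ 5, q ^ 9, q ^ 14] (q ^ 14)
               * qpoch_inf_list [q ^ 4, q ^ 24] (q ^ 28) * qpoch_inf (- q) (q ^ 2)
               / qpoch_inf (q ^ 2) (q ^ 2) * G m)"
      using has_sum_imp_sums[OF even_series[OF q, of m]] P[of 1] Q[of 1] R[of 1]
      unfolding even_term_def [abs_def] by simp
  qed
qed

end
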